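(* Let $G$ be an (unlabelled) graph isomorphic to a daisy cube, with $n$ vertices and $m$ edges. The following algorithm outputs a proper labelling of $G$ and runs in $O(mn)$ time: compute the $\Theta$-classes $\Theta_1,\dots,\Theta_k$ of $G$; for each $i=1,\dots,k$, choose an arbitrary edge $ab\in\Theta_i$, determine $W_{ab}$ and $W_{ba}$, and if $|W_{ab}|\ge|W_{ba}|$ set the $i$-th coordinate of the label of every vertex of $W_{ab}$ to $0$ and of every vertex of $W_{ba}$ to $1$, otherwise set the $i$-th coordinate of every vertex of $W_{ba}$ to $0$ and of every vertex of $W_{ab}$ to $1$. (Each vertex thereby receives a label in $\{0,1\}^k$.)
   Context: $B=\{0,1\}$; $Q_k$ has vertex set $B^k$, two strings adjacent iff they differ in exactly one position. For $u,v\in B^k$ write $u\le v$ if $u_i\le v_i$ for all $i$. For $X\subseteq B^k$ the daisy cube $Q_k(X)$ is the subgraph of $Q_k$ induced by $\{u: u\le x\text{ for some }x\in X\}$; a graph is a daisy cube if isomorphic to some $Q_k(X)$. A labelling of $G$ is an isometric embedding $\varphi$ of $G$ into some $Q_k$; it is proper if $\varphi(V(G))$ is closed downward under $\le$, i.e. $G\cong Q_k(\varphi(V(G)))$ via $\varphi$. Edges $xy,uv$ of a connected graph are in relation $\Theta$ if $d(x,u)+d(y,v)\ne d(x,v)+d(y,u)$; $\Theta$-classes are the equivalence classes of the transitive closure of $\Theta$. For an edge $ab$: $W_{ab}=\{w: d(a,w)<d(b,w)\}$, $W_{ba}=\{w: d(b,w)<d(a,w)\}$. *)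

theory Defs
  imports Main
begin

section \<open>Graphs\<close>

record 'a sgraph =
  verts :: "'a set"
  edges :: "'a set set"

definition simple_graph :: "'a sgraph \<Rightarrow> bool" where
  "simple_graph G \<longleftrightarrow> finite (verts G) \<and>
     edges G \<subseteq> {{u, v} | u v. u \<in> verts G \<and> v \<in> verts G \<and> u \<noteq> v}"

definition induced_subgraph :: "'a sgraph \<Rightarrow> 'a set \<Rightarrow> 'a sgraph" where
  "induced_subgraph G S = \<lparr>verts = verts G \<inter> S, edges = {e \<in> edges G. e \<subseteq> S}\<rparr>"

definition graph_iso :: "('a \<Rightarrow> 'b) \<Rightarrow> 'a sgraph \<Rightarrow> 'b sgraph \<Rightarrow> bool" where
  "graph_iso f G H \<longleftrightarrow> bij_betw f (verts G) (verts H) \<and>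
     (\<forall>u \<in> verts G. \<forall>v \<in> verts G. {u, v} \<in> edges G \<longleftrightarrow> {f u, f v} \<in> edges H)"

text \<open>
  A pair belongs to the \<open>n\<close>-th relational power of the adjacency relation iff it is joined by a
  walk of length \<open>n\<close>. The value of \<open>gdist\<close> is meaningful only for two vertices in the same
  component.
\<close>

definition gdist :: "'a sgraph \<Rightarrow> 'a \<Rightarrow> 'a \<Rightarrow> nat" where
  "gdist G u v = (LEAST n. (u, v) \<in> {(x, y). {x, y} \<in> edges G} ^^ n)"


section \<open>Daisy cubes and their labellings\<close>

definition strings :: "nat \<Rightarrow> bool list set" where
  "strings k = {u. length u = k}"

definition hypercube :: "nat \<Rightarrow> bool list sgraph" where
  "hypercube k = \<lparr>verts = strings k,
     edges = {{u, v} | u v. u \<in> strings k \<and> v \<in> strings k \<and> card {i. i < k \<and> u ! i \<noteq> v ! i} = 1}\<rparr>"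

definition string_le :: "bool list \<Rightarrow> bool list \<Rightarrow> bool" where
  "string_le u v \<longleftrightarrow> list_all2 (\<le>) u v"

definition daisy_cube :: "nat \<Rightarrow> bool list set \<Rightarrow> bool list sgraph" where
  "daisy_cube k X = induced_subgraph (hypercube k) {u. \<exists>x \<in> X. string_le u x}"

definition is_daisy_cube :: "'a sgraph \<Rightarrow> bool" where
  "is_daisy_cube G \<longleftrightarrow> simple_graph G \<and>
     (\<exists>k X f. X \<subseteq> strings k \<and> graph_iso f G (daisy_cube k X))"

definition labelling :: "'a sgraph \<Rightarrow> nat \<Rightarrow> ('a \<Rightarrow> bool list) \<Rightarrow> bool" where
  "labelling G k \<phi> \<longleftrightarrow> \<phi> ` verts G \<subseteq> strings k \<and>
     (\<forall>u \<in> verts G. \<forall>v \<in> verts G. gdist (hypercube k) (\<phi> u) (\<phi> v) = gdist G u v)"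

definition proper_labelling :: "'a sgraph \<Rightarrow> nat \<Rightarrow> ('a \<Rightarrow> bool list) \<Rightarrow> bool" where
  "proper_labelling G k \<phi> \<longleftrightarrow> labelling G k \<phi> \<and>
     (\<forall>x \<in> \<phi> ` verts G. \<forall>u \<in> strings k. string_le u x \<longrightarrow> u \<in> \<phi> ` verts G)"


section \<open>The relation \<open>\<Theta>\<close> and the labelling algorithm\<close>

definition theta :: "'a sgraph \<Rightarrow> ('a set \<times> 'a set) set" where
  "theta G = {(e, f). e \<in> edges G \<and> f \<in> edges G \<and>
     (\<exists>x y u v. e = {x, y} \<and> f = {u, v} \<and>
        gdist G x u + gdist G y v \<noteq> gdist G x v + gdist G y u)}"

definition theta_classes :: "'a sgraph \<Rightarrow> 'a set set set" where
  "theta_classes G = edges G // (theta G)\<^sup>+"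

definition W :: "'a sgraph \<Rightarrow> 'a \<Rightarrow> 'a \<Rightarrow> 'a set" where
  "W G a b = {w \<in> verts G. gdist G a w < gdist G b w}"

text \<open>
  \<open>algorithm_output G \<Theta>s \<phi>\<close>: the labelling \<open>\<phi>\<close> is a possible result of the algorithm when it goes
  through the \<open>\<Theta>\<close>-classes in the order \<open>\<Theta>s\<close>; \<open>a i\<close> and \<open>b i\<close> are the ends of the edge chosen in
  the \<open>i\<close>-th class. Nothing is said about a coordinate which the algorithm does not set.
\<close>

definition algorithm_output :: "'a sgraph \<Rightarrow> 'a set set list \<Rightarrow> ('a \<Rightarrow> bool list) \<Rightarrow> bool" where
  "algorithm_output G \<Theta>s \<phi> \<longleftrightarrow>
     distinct \<Theta>s \<and> set \<Theta>s = theta_classes G \<and>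
     (\<forall>w \<in> verts G. length (\<phi> w) = length \<Theta>s) \<and>
     (\<exists>a b. \<forall>i < length \<Theta>s. {a i, b i} \<in> \<Theta>s ! i \<and>
        (if card (W G (a i) (b i)) \<ge> card (W G (b i) (a i))
         then (\<forall>w \<in> W G (a i) (b i). \<phi> w ! i = False) \<and> (\<forall>w \<in> W G (b i) (a i). \<phi> w ! i = True)
         else (\<forall>w \<in> W G (b i) (a i). \<phi> w ! i = False) \<and> (\<forall>w \<in> W G (a i) (b i). \<phi> w ! i = True)))"


section \<open>A random access machine with unit costs\<close>

text \<open>
  The memory consists of finitely many arrays of natural numbers. A scalar variable is the cell
  with index 0 of an array of its own. Every operator, constant, memory access, store and branch
  costs one unit.
\<close>

datatype array =
    Size | Off | Adj | Choice
  | Tail | Cls | NumCls | Lab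
  | DistA | DistB | Queue | Head | End
  | Vert | Arc | Edge | Class | EndA | EndB
  | Cand | NumCand | CountA | CountB | BitA | BitB | Base

type_synonym memory = "array \<Rightarrow> nat \<Rightarrow> nat"

datatype aexp =
    Const nat
  | Cell array aexp  ("_\<^bold>[_\<^bold>]" [1000, 0] 1000)
  | Plus aexp aexp  (infixl "\<^bold>+" 65)
  | Modulo aexp aexp  (infixl "\<^bold>%" 70)

datatype bexp =
    Less aexp aexp  (infix "\<^bold><" 50)
  | Equal aexp aexp  (infix "\<^bold>=" 50)

datatype com =
    Skip
  | Store array aexp aexp  ("_\<^bold>[_\<^bold>] ::= _" [1000, 0, 61] 61)
  | Seq com com  (infixr ";;" 60)
  | Cond bexp com com  ("(IF _ THEN _ ELSE _)" [0, 0, 61] 61)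
  | Loop bexp com  ("(WHILE _ DO _)" [0, 61] 61)

fun aval :: "aexp \<Rightarrow> memory \<Rightarrow> nat" where
  "aval (Const c) s = c"
| "aval (Cell x e) s = s x (aval e s)"
| "aval (Plus e f) s = aval e s + aval f s"
| "aval (Modulo e f) s = aval e s mod aval f s"

fun acost :: "aexp \<Rightarrow> nat" where
  "acost (Const c) = 1"
| "acost (Cell x e) = acost e + 1"
| "acost (Plus e f) = acost e + acost f + 1"
| "acost (Modulo e f) = acost e + acost f + 1"

fun bval :: "bexp \<Rightarrow> memory \<Rightarrow> bool" where
  "bval (Less e f) s = (aval e s < aval f s)"
| "bval (Equal e f) s = (aval e s = aval f s)"

fun bcost :: "bexp \<Rightarrow> nat" where
  "bcost (Less e f) = acost e + acost f + 1"
| "bcost (Equal e f) = acost e + acost f + 1"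

text \<open>\<open>exec c s t s'\<close>: started in \<open>s\<close>, the command \<open>c\<close> halts in \<open>s'\<close> after \<open>t\<close> units of time.\<close>

inductive exec :: "com \<Rightarrow> memory \<Rightarrow> nat \<Rightarrow> memory \<Rightarrow> bool" where
  exec_Skip: "exec Skip s 1 s"
| exec_Store: "exec (Store x e f) s (acost e + acost f + 1)
    (s(x := (s x)(aval e s := aval f s)))"
| exec_Seq: "exec c s t s' \<Longrightarrow> exec d s' t' s'' \<Longrightarrow> exec (Seq c d) s (t + t') s''"
| exec_Cond_True: "bval p s \<Longrightarrow> exec c s t s' \<Longrightarrow> exec (Cond p c d) s (bcost p + t + 1) s'"
| exec_Cond_False: "\<not> bval p s \<Longrightarrow> exec d s t s' \<Longrightarrow> exec (Cond p c d) s (bcost p + t + 1) s'"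
| exec_Loop_False: "\<not> bval p s \<Longrightarrow> exec (Loop p c) s (bcost p + 1) s"
| exec_Loop_True: "bval p s \<Longrightarrow> exec c s t s' \<Longrightarrow> exec (Loop p c) s' t' s'' \<Longrightarrow>
    exec (Loop p c) s (bcost p + t + t' + 1) s''"

inductive_cases exec_SkipE: "exec Skip s t s'"
inductive_cases exec_StoreE: "exec (Store x e f) s t s'"
inductive_cases exec_SeqE: "exec (Seq c d) s t s'"
inductive_cases exec_CondE: "exec (Cond p c d) s t s'"
inductive_cases exec_LoopE: "exec (Loop p c) s t s'"

lemma exec_deterministic:
  "exec c s t s' \<Longrightarrow> exec c s u s'' \<Longrightarrow> t = u \<and> s' = s''"
proof (induction arbitrary: u s'' rule: exec.induct)
  case (exec_Skip s)
  then show ?case by (auto elim: exec_SkipE)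
next
  case (exec_Store x e f s)
  then show ?case by (auto elim: exec_StoreE)
next
  case (exec_Seq c s t s1 d t' s2)
  from exec_Seq.prems show ?case
    by (rule exec_SeqE) (use exec_Seq.IH in metis)
next
  case (exec_Cond_True p s c t s1 d)
  from exec_Cond_True.prems show ?case
    by (rule exec_CondE) (use exec_Cond_True.hyps exec_Cond_True.IH in fastforce)+
next
  case (exec_Cond_False p s d t s1 c)
  from exec_Cond_False.prems show ?case
    by (rule exec_CondE) (use exec_Cond_False.hyps exec_Cond_False.IH in fastforce)+
next
  case (exec_Loop_False p s c)
  from exec_Loop_False.prems show ?case
    by (rule exec_LoopE) (use exec_Loop_False in simp_all)
next
  case (exec_Loop_True p s c t s1 t' s2)
  from exec_Loop_True.prems show ?case
    by (rule exec_LoopE) (use exec_Loop_True.hyps exec_Loop_True.IH in fastforce)+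
qed


section \<open>The algorithm as a program\<close>

abbreviation deref :: "array \<Rightarrow> aexp"  ("\<^bold>!_" [1000] 1000) where
  "\<^bold>!x \<equiv> x\<^bold>[Const 0\<^bold>]"

abbreviation assign :: "array \<Rightarrow> aexp \<Rightarrow> com"  (infix ":==" 61) where
  "x :== e \<equiv> x\<^bold>[Const 0\<^bold>] ::= e"

definition incr :: "array \<Rightarrow> com" where
  "incr x = (x :== \<^bold>!x \<^bold>+ Const 1)"

definition for_loop :: "array \<Rightarrow> aexp \<Rightarrow> aexp \<Rightarrow> com \<Rightarrow> com" where
  "for_loop x lo hi c = (x :== lo ;; WHILE \<^bold>!x \<^bold>< hi DO (c ;; incr x))"

text \<open>
  The input graph, on the vertices \<open>0, \<dots>, n - 1\<close>, is given by adjacency lists: \<open>Size\<close> holds \<open>n\<close>, and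
  the neighbours of \<open>v\<close> are stored without repetition in the cells of \<open>Adj\<close> with indices from
  \<open>Off v\<close> up to, but excluding, \<open>Off (v + 1)\<close>. Each edge \<open>uv\<close> thus appears as two arcs, one in the
  list of \<open>u\<close> and one in the list of \<open>v\<close>. The remaining memory is not assumed to be initialised.
\<close>

definition represents :: "memory \<Rightarrow> nat sgraph \<Rightarrow> bool" where
  "represents s G \<longleftrightarrow>
     verts G = {..<s Size 0} \<and> s Off 0 = 0 \<and>
     (\<forall>v < s Size 0. s Off v \<le> s Off (Suc v) \<and>
        distinct (map (s Adj) [s Off v..<s Off (Suc v)]) \<and>
        set (map (s Adj) [s Off v..<s Off (Suc v)]) = {w. {v, w} \<in> edges G})"

abbreviation num_arcs :: aexp where
  "num_arcs \<equiv> Off\<^bold>[\<^bold>!Size\<^bold>]"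

definition compute_tails :: com where
  "compute_tails =
     for_loop Vert (Const 0) (\<^bold>!Size)
       (for_loop Arc (Off\<^bold>[\<^bold>!Vert\<^bold>]) (Off\<^bold>[\<^bold>!Vert \<^bold>+ Const 1\<^bold>])
         (Tail\<^bold>[\<^bold>!Arc\<^bold>] ::= \<^bold>!Vert))"

text \<open>Breadth-first search; the distance \<open>n\<close> marks a vertex that has not been reached yet.\<close>

definition bfs :: "array \<Rightarrow> array \<Rightarrow> com" where
  "bfs root D =
     for_loop Vert (Const 0) (\<^bold>!Size) (D\<^bold>[\<^bold>!Vert\<^bold>] ::= \<^bold>!Size) ;;
     D\<^bold>[\<^bold>!root\<^bold>] ::= Const 0 ;;
     Queue\<^bold>[Const 0\<^bold>] ::= \<^bold>!root ;;
     Head :== Const 0 ;;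
     End :== Const 1 ;;
     WHILE \<^bold>!Head \<^bold>< \<^bold>!End DO
       (Vert :== Queue\<^bold>[\<^bold>!Head\<^bold>] ;;
        incr Head ;;
        for_loop Arc (Off\<^bold>[\<^bold>!Vert\<^bold>]) (Off\<^bold>[\<^bold>!Vert \<^bold>+ Const 1\<^bold>])
          (IF D\<^bold>[Adj\<^bold>[\<^bold>!Arc\<^bold>]\<^bold>] \<^bold>= \<^bold>!Size
           THEN (D\<^bold>[Adj\<^bold>[\<^bold>!Arc\<^bold>]\<^bold>] ::= D\<^bold>[\<^bold>!Vert\<^bold>] \<^bold>+ Const 1 ;;
                 Queue\<^bold>[\<^bold>!End\<^bold>] ::= Adj\<^bold>[\<^bold>!Arc\<^bold>] ;;
                 incr End)
           ELSE Skip))"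

definition end_distances :: com where
  "end_distances =
     EndA :== Tail\<^bold>[\<^bold>!Edge\<^bold>] ;;
     EndB :== Adj\<^bold>[\<^bold>!Edge\<^bold>] ;;
     bfs EndA DistA ;;
     bfs EndB DistB"

text \<open>
  An arc whose class is still unknown (marked by the number of arcs) starts a new class, which
  receives all the arcs in relation \<open>\<Theta>\<close> with it. This yields the classes of the transitive closure
  because \<open>\<Theta>\<close> is already transitive on graphs embeddable isometrically into a hypercube.
\<close>

definition compute_theta_classes :: com where
  "compute_theta_classes =
     for_loop Arc (Const 0) num_arcs (Cls\<^bold>[\<^bold>!Arc\<^bold>] ::= num_arcs) ;;
     NumCls :== Const 0 ;;
     for_loop Edge (Const 0) num_arcs
       (IF Cls\<^bold>[\<^bold>!Edge\<^bold>] \<^bold>= num_arcs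
        THEN (end_distances ;;
              for_loop Arc (Const 0) num_arcs
                (IF DistA\<^bold>[Tail\<^bold>[\<^bold>!Arc\<^bold>]\<^bold>] \<^bold>+ DistB\<^bold>[Adj\<^bold>[\<^bold>!Arc\<^bold>]\<^bold>] \<^bold>=
                    DistA\<^bold>[Adj\<^bold>[\<^bold>!Arc\<^bold>]\<^bold>] \<^bold>+ DistB\<^bold>[Tail\<^bold>[\<^bold>!Arc\<^bold>]\<^bold>]
                 THEN Skip
                 ELSE Cls\<^bold>[\<^bold>!Arc\<^bold>] ::= \<^bold>!NumCls) ;;
              incr NumCls)
        ELSE Skip)"

text \<open>
  The contents of the array \<open>Choice\<close> are arbitrary: they select an arbitrary arc, that is, an
  arbitrary edge \<open>ab\<close> together with the order of its ends, among the candidates of the class.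
\<close>

definition choose_edge :: com where
  "choose_edge =
     NumCand :== Const 0 ;;
     for_loop Arc (Const 0) num_arcs
       (IF Cls\<^bold>[\<^bold>!Arc\<^bold>] \<^bold>= \<^bold>!Class
        THEN (Cand\<^bold>[\<^bold>!NumCand\<^bold>] ::= \<^bold>!Arc ;; incr NumCand)
        ELSE Skip) ;;
     Edge :== Cand\<^bold>[Choice\<^bold>[\<^bold>!Class\<^bold>] \<^bold>% \<^bold>!NumCand\<^bold>]"

definition split_vertices :: "com \<Rightarrow> com \<Rightarrow> com" where
  "split_vertices c d =
     for_loop Vert (Const 0) (\<^bold>!Size)
       (IF DistA\<^bold>[\<^bold>!Vert\<^bold>] \<^bold>< DistB\<^bold>[\<^bold>!Vert\<^bold>] THEN c
        ELSE IF DistB\<^bold>[\<^bold>!Vert\<^bold>] \<^bold>< DistA\<^bold>[\<^bold>!Vert\<^bold>] THEN d ELSE Skip)"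

text \<open>The \<open>i\<close>-th coordinate of the label of \<open>v\<close> is stored in the cell \<open>i * n + v\<close> of \<open>Lab\<close>.\<close>

definition compute_labels :: com where
  "compute_labels =
     Base :== Const 0 ;;
     for_loop Class (Const 0) (\<^bold>!NumCls)
       (choose_edge ;;
        end_distances ;;
        CountA :== Const 0 ;;
        CountB :== Const 0 ;;
        split_vertices (incr CountA) (incr CountB) ;;
        IF \<^bold>!CountA \<^bold>< \<^bold>!CountB
        THEN (BitA :== Const 1 ;; BitB :== Const 0)
        ELSE (BitA :== Const 0 ;; BitB :== Const 1) ;;
        split_vertices (Lab\<^bold>[\<^bold>!Base \<^bold>+ \<^bold>!Vert\<^bold>] ::= \<^bold>!BitA) (Lab\<^bold>[\<^bold>!Base \<^bold>+ \<^bold>!Vert\<^bold>] ::= \<^bold>!BitB) ;;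
        Base :== \<^bold>!Base \<^bold>+ \<^bold>!Size)"

definition labelling_program :: com where
  "labelling_program = compute_tails ;; compute_theta_classes ;; compute_labels"

definition stored_classes :: "memory \<Rightarrow> nat set set list" where
  "stored_classes s =
     map (\<lambda>i. {{s Tail j, s Adj j} | j. j < s Off (s Size 0) \<and> s Cls j = i}) [0..<s NumCls 0]"

definition stores_labelling :: "memory \<Rightarrow> nat sgraph \<Rightarrow> nat \<Rightarrow> (nat \<Rightarrow> bool list) \<Rightarrow> bool" where
  "stores_labelling s G k \<phi> \<longleftrightarrow>
     (\<forall>v \<in> verts G. length (\<phi> v) = k \<and>
        (\<forall>i < k. s Lab (i * card (verts G) + v) = of_bool (\<phi> v ! i)))"

end

theory Submission
  imports Defs
begin

text \<open>
  In a daisy cube, distances are Hamming distances, two edges are in relation \<open>\<Theta>\<close> iff they flip the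
  same coordinate \<open>i\<close>, and \<open>W\<^sub>a\<^sub>b\<close>, \<open>W\<^sub>b\<^sub>a\<close> are the sets of strings with a fixed \<open>i\<close>-th bit.
  Clearing the \<open>i\<close>-th bit injects the strings with bit 1 into those with bit 0. So the algorithm
  recovers the \<open>i\<close>-th bit of the original labelling, unless both sides have equal size; then the
  injection is a bijection, and complementing the \<open>i\<close>-th bit preserves the set of labels.

  The program runs two breadth-first searches, each in time \<open>O(n + m)\<close>, once per class in each of
  its two phases. There are at most \<open>n\<close> classes, because every used coordinate \<open>i\<close> contributes the
  string whose only 1 is in position \<open>i\<close>, and \<open>n\<close> is \<open>O(m)\<close> by connectedness if \<open>n \<ge> 2\<close>.
\<close>

section \<open>Hamming distance\<close>

text \<open>The output is therefore compared with \<open>f\<close> through an injection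
  \<open>\<sigma>\<close> of output coordinates into those of \<open>f\<close> and a complementation
  flag \<open>c\<close> for each of them. Ties may occur in several coordinates at once; they do not
  interact, because downward closure is only ever used one bit at a time: clearing an output bit
  means clearing or setting one bit of \<open>f\<close>, and a tie permits setting.

  The program is verified against the relation \<open>algorithm_output\<close>, so its final memory
  only has to exhibit some admissible choice of edges. Its search loop is paid for by vertex degrees
  rather than by a worst case per iteration. The numerical constants are sums of unit costs,
  generously rounded up.\<close>

definition hdist :: "nat \<Rightarrow> bool list \<Rightarrow> bool list \<Rightarrow> nat" where
  "hdist k u v = card {i. i < k \<and> u ! i \<noteq> v ! i}"

lemma hdist_commute: "hdist k u v = hdist k v u"
  unfolding hdist_def by (rule arg_cong[where f = card]) auto

lemma hdist_self [simp]: "hdist k u u = 0"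
  by (simp add: hdist_def)

lemma hdist_triangle: "hdist k u w \<le> hdist k u v + hdist k v w"
proof -
  have "hdist k u w \<le> card ({i. i < k \<and> u ! i \<noteq> v ! i} \<union> {i. i < k \<and> v ! i \<noteq> w ! i})"
    unfolding hdist_def by (intro card_mono) auto
  also have "\<dots> \<le> hdist k u v + hdist k v w"
    unfolding hdist_def by (rule card_Un_le)
  finally show ?thesis .
qed

lemma hdist_eq_0D:
  assumes "hdist k u v = 0" "length u = k" "length v = k"
  shows "u = v"
  using assms by (intro nth_equalityI) (auto simp: hdist_def)

lemma hdist_flip:
  assumes "i < k" "length u = k" "b \<noteq> u ! i"
  shows "hdist k u (u[i := b]) = 1"
proof -
  have "{j. j < k \<and> u ! j \<noteq> u[i := b] ! j} = {i}"
    using assms by (auto simp: nth_list_update)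
  then show ?thesis by (simp add: hdist_def)
qed

text \<open>Each bit made to agree lowers the distance by exactly one; most later comparisons of
  distances come down to this.\<close>

lemma hdist_agree:
  assumes "i < k" "length u = k" "u ! i \<noteq> v ! i"
  shows "hdist k u v = Suc (hdist k (u[i := v ! i]) v)"
proof -
  have "{j. j < k \<and> u ! j \<noteq> v ! j} = insert i {j. j < k \<and> u[i := v ! i] ! j \<noteq> v ! j}"
    using assms by (auto simp: nth_list_update)
  moreover have "i \<notin> {j. j < k \<and> u[i := v ! i] ! j \<noteq> v ! j}"
    using assms by auto
  ultimately show ?thesis by (simp add: hdist_def)
qed

lemma hdist_1_flip:
  assumes "hdist k u v = 1" "i < k" "u ! i \<noteq> v ! i" "length u = k" "length v = k"
  shows "v = u[i := v ! i]"
  using assms hdist_agree[of i k u v] hdist_eq_0D[of k "u[i := v ! i]" v] by simp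

lemma hdist_1_same:
  assumes "hdist k u v = 1" "i < k" "u ! i \<noteq> v ! i" "length u = k" "length v = k"
    "j < k" "u ! j \<noteq> v ! j"
  shows "j = i"
  using hdist_1_flip[OF assms(1-5)] assms(4-7) by (metis nth_list_update_neq)

section \<open>Graphs labelled by a down-closed set of strings\<close>

text \<open>The generating set \<open>X\<close> disappears: what remains of it is closure under
  clearing a single bit, which yields full downward closure by iteration. The ambient hypercube with
  its identity labels is an instance too.\<close>

locale daisy_graph =
  fixes G :: "'a sgraph" and k :: nat and f :: "'a \<Rightarrow> bool list"
  assumes finite_verts: "finite (verts G)"
    and edge_form: "e \<in> edges G \<Longrightarrow> \<exists>u v. e = {u, v}"
    and edge_verts: "{u, v} \<in> edges G \<Longrightarrow> u \<in> verts G \<and> v \<in> verts G"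
    and inj_f: "inj_on f (verts G)"
    and length_f: "u \<in> verts G \<Longrightarrow> length (f u) = k"
    and clear_bit: "u \<in> verts G \<Longrightarrow> i < k \<Longrightarrow> f u ! i \<Longrightarrow> (f u)[i := False] \<in> f ` verts G"
    and edge_iff: "u \<in> verts G \<Longrightarrow> v \<in> verts G \<Longrightarrow> {u, v} \<in> edges G \<longleftrightarrow> hdist k (f u) (f v) = 1"
begin

section \<open>Graph distance as Hamming distance\<close>

abbreviation adj_rel :: "('a \<times> 'a) set" where
  "adj_rel \<equiv> {(x, y). {x, y} \<in> edges G}"

lemma hdist_le_walk:
  "(u, v) \<in> adj_rel ^^ n \<Longrightarrow> u \<in> verts G \<Longrightarrow> hdist k (f u) (f v) \<le> n"
proof (induction n arbitrary: v)
  case (Suc n)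
  then obtain w where w: "(u, w) \<in> adj_rel ^^ n" "{w, v} \<in> edges G" by auto
  then have "hdist k (f w) (f v) = 1" using edge_iff edge_verts by blast
  moreover have "hdist k (f u) (f w) \<le> n" using Suc.IH Suc.prems w by blast
  ultimately show ?case using hdist_triangle[of k "f u" "f v" "f w"] by linarith
qed simp

text \<open>A shortest walk is found by clearing a bit of either end in which the two ends differ.\<close>

lemma walk_of_hdist:
  "u \<in> verts G \<Longrightarrow> v \<in> verts G \<Longrightarrow> hdist k (f u) (f v) = n \<Longrightarrow> (u, v) \<in> adj_rel ^^ n"
proof (induction n arbitrary: u v)
  case 0
  then have "f u = f v" using hdist_eq_0D length_f by metis
  then show ?case using 0 inj_f by (simp add: inj_on_eq_iff)
next
  case (Suc n)
  have step: "\<exists>y \<in> verts G. {x, y} \<in> edges G \<and> hdist k (f y) (f z) = n"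
    if x: "x \<in> verts G" and z: "z \<in> verts G" and d: "hdist k (f x) (f z) = Suc n"
      and i: "i < k" "f x ! i" "\<not> f z ! i" for x z i
  proof -
    obtain y where y: "y \<in> verts G" "f y = (f x)[i := False]"
      using clear_bit[OF x i(1,2)] by auto
    have "hdist k (f x) (f z) = Suc (hdist k ((f x)[i := f z ! i]) (f z))"
      using hdist_agree i length_f x by blast
    moreover have "hdist k (f x) (f y) = 1"
      unfolding y(2) using hdist_flip i length_f x by blast
    ultimately have "{x, y} \<in> edges G" "hdist k (f y) (f z) = n" using d y x i edge_iff by auto
    then show ?thesis using y by blast
  qed
  have "{i. i < k \<and> f u ! i \<noteq> f v ! i} \<noteq> {}"
    using Suc.prems(3) unfolding hdist_def by (metis card.empty nat.distinct(1))
  then obtain i where i: "i < k" "f u ! i \<noteq> f v ! i" by auto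
  show ?case
  proof (cases "f u ! i")
    case True
    then obtain y where "y \<in> verts G" "{u, y} \<in> edges G" "hdist k (f y) (f v) = n"
      using step[OF Suc.prems] i by auto
    then show ?thesis using Suc.IH Suc.prems by (intro relpow_Suc_I2[of u y]) auto
  next
    case False
    then obtain y where "y \<in> verts G" "{v, y} \<in> edges G" "hdist k (f y) (f u) = n"
      using step[of v u i] Suc.prems i by (auto simp: hdist_commute)
    then show ?thesis using Suc.IH Suc.prems
      by (intro relpow_Suc_I[of u y]) (auto simp: hdist_commute insert_commute)
  qed
qed

lemma gdist_eq:
  assumes "u \<in> verts G" "v \<in> verts G"
  shows "gdist G u v = hdist k (f u) (f v)"
  unfolding gdist_def using assms by (intro Least_equality walk_of_hdist) (auto intro: hdist_le_walk)

section \<open>Edge directions, sides of an edge and the relation \<Theta>\<close>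

lemma edge_direction:
  assumes "{a, b} \<in> edges G"
  obtains i where "i < k" "f a ! i \<noteq> f b ! i"
proof -
  have "hdist k (f a) (f b) = 1" using assms edge_iff edge_verts by blast
  then have "{i. i < k \<and> f a ! i \<noteq> f b ! i} \<noteq> {}" unfolding hdist_def by (metis card.empty zero_neq_one)
  then show ?thesis using that by auto
qed

lemma edge_direction_unique:
  assumes "{a, b} \<in> edges G" "i < k" "f a ! i \<noteq> f b ! i" "j < k" "f a ! j \<noteq> f b ! j"
  shows "j = i"
proof -
  have "a \<in> verts G" "b \<in> verts G" using edge_verts[OF assms(1)] by auto
  moreover from this have "hdist k (f a) (f b) = 1" using edge_iff assms(1) by blast
  ultimately show ?thesis using hdist_1_same[of k "f a" "f b" i j] length_f assms by simp
qed

text \<open>The labels of \<open>a\<close> and \<open>b\<close> differ in bit \<open>i\<close> only,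
  so moving from one end to the other changes the distance to \<open>w\<close> by exactly one, with
  a sign given by the \<open>i\<close>-th bit of \<open>w\<close>. Both \<open>W\<close> and
  \<Theta> are read off from this.\<close>

lemma gdist_edge_ends:
  assumes "{a, b} \<in> edges G" "i < k" "f a ! i \<noteq> f b ! i" "w \<in> verts G"
  shows "if f w ! i = f a ! i then gdist G b w = Suc (gdist G a w)
         else gdist G a w = Suc (gdist G b w)"
proof -
  have ab: "a \<in> verts G" "b \<in> verts G" using edge_verts[OF assms(1)] by auto
  then have d: "hdist k (f a) (f b) = 1" "hdist k (f b) (f a) = 1"
    using edge_iff assms(1) by (auto simp: hdist_commute)
  note len = length_f[OF ab(1)] length_f[OF ab(2)]
  have fb: "(f a)[i := f b ! i] = f b" and fa: "(f b)[i := f a ! i] = f a"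
    using hdist_1_flip[OF d(1) assms(2,3) len] hdist_1_flip[OF d(2) assms(2) _ len(2,1)] assms(3)
    by auto
  show ?thesis
  proof (cases "f w ! i = f a ! i")
    case True
    then have "hdist k (f b) (f w) = Suc (hdist k (f a) (f w))"
      using hdist_agree[OF assms(2) len(2), of "f w"] assms(3) fa by simp
    then show ?thesis using True by (simp add: gdist_eq ab assms(4))
  next
    case False
    then have "f w ! i = f b ! i" using assms(3) by auto
    then have "hdist k (f a) (f w) = Suc (hdist k (f b) (f w))"
      using hdist_agree[OF assms(2) len(1), of "f w"] assms(3) fb by simp
    then show ?thesis using False by (simp add: gdist_eq ab assms(4))
  qed
qed

lemma W_edge:
  assumes "{a, b} \<in> edges G" "i < k" "f a ! i \<noteq> f b ! i"
  shows "W G a b = {w \<in> verts G. f w ! i = f a ! i}"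
proof -
  have "gdist G a w < gdist G b w \<longleftrightarrow> f w ! i = f a ! i" if "w \<in> verts G" for w
    using gdist_edge_ends[OF assms that] by (auto split: if_splits)
  then show ?thesis unfolding W_def by blast
qed

text \<open>The two sums differ iff \<open>gdist G x u - gdist G y u\<close> and
  \<open>gdist G x v - gdist G y v\<close> differ as integers. Each of these is 1 or -1, with a sign
  determined by bit \<open>i\<close> of \<open>u\<close> and of \<open>v\<close>
  respectively.\<close>

lemma gdist_theta_iff:
  assumes "{x, y} \<in> edges G" "i < k" "f x ! i \<noteq> f y ! i" "u \<in> verts G" "v \<in> verts G"
  shows "gdist G x u + gdist G y v \<noteq> gdist G x v + gdist G y u \<longleftrightarrow> f u ! i \<noteq> f v ! i"
  using gdist_edge_ends[OF assms(1-3) assms(4)] gdist_edge_ends[OF assms(1-3) assms(5)]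
  by (auto split: if_splits)

text \<open>For \<open>i < k\<close> this is empty exactly when no label has a 1 in position
  \<open>i\<close>: a label with a 1 there is joined by an edge to the label with that bit
  cleared.\<close>

definition dir_class :: "nat \<Rightarrow> 'a set set" where
  "dir_class i = {e \<in> edges G. \<exists>u v. e = {u, v} \<and> f u ! i \<noteq> f v ! i}"

lemma doubleton_in_dir_class:
  "{u, v} \<in> dir_class i \<longleftrightarrow> {u, v} \<in> edges G \<and> f u ! i \<noteq> f v ! i"
  unfolding dir_class_def by (auto simp: doubleton_eq_iff)

lemma dir_class_disjoint:
  assumes "e \<in> dir_class i" "e \<in> dir_class j" "i < k" "j < k"
  shows "i = j"
proof -
  obtain u v where "e = {u, v}" using assms edge_form unfolding dir_class_def by blast
  then show ?thesis using assms edge_direction_unique by (metis doubleton_in_dir_class)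
qed

text \<open>In this form, a union of squares of pairwise disjoint sets, the relation is visibly
  transitive, so that forming the transitive closure changes nothing.\<close>

lemma theta_eq: "theta G = (\<Union>i<k. dir_class i \<times> dir_class i)"
proof (intro set_eqI iffI; clarify)
  fix e g assume "(e, g) \<in> theta G"
  then obtain x y u v where *: "e = {x, y}" "g = {u, v}" "{x, y} \<in> edges G" "{u, v} \<in> edges G"
    "gdist G x u + gdist G y v \<noteq> gdist G x v + gdist G y u" unfolding theta_def by auto
  obtain i where i: "i < k" "f x ! i \<noteq> f y ! i" using edge_direction * by blast
  have "f u ! i \<noteq> f v ! i" using gdist_theta_iff[OF _ i] * edge_verts by blast
  then show "(e, g) \<in> (\<Union>i<k. dir_class i \<times> dir_class i)"
    using i * by (auto simp: doubleton_in_dir_class)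
next
  fix e g i assume i: "i < k" and e: "e \<in> dir_class i" and g: "g \<in> dir_class i"
  obtain x y where x: "e = {x, y}" "f x ! i \<noteq> f y ! i" using e unfolding dir_class_def by auto
  obtain u v where u: "g = {u, v}" "f u ! i \<noteq> f v ! i" using g unfolding dir_class_def by auto
  have ed: "{x, y} \<in> edges G" "{u, v} \<in> edges G"
    using e g x u by (auto simp: doubleton_in_dir_class)
  have "gdist G x u + gdist G y v \<noteq> gdist G x v + gdist G y u"
    using gdist_theta_iff[OF ed(1) i x(2)] edge_verts[OF ed(2)] u(2) by blast
  then show "(e, g) \<in> theta G" using ed x u unfolding theta_def by blast
qed

lemma theta_classes_eq: "theta_classes G = {dir_class i |i. i < k \<and> dir_class i \<noteq> {}}"
proof -
  have "trans (theta G)"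
    unfolding theta_eq using dir_class_disjoint by (intro transI) blast
  then have tc: "theta_classes G = edges G // theta G"
    unfolding theta_classes_def by (simp add: trancl_id)
  have img: "theta G `` {e} = dir_class i" if "e \<in> dir_class i" "i < k" for e i
    using that dir_class_disjoint unfolding theta_eq by blast
  have ex: "\<exists>i<k. e \<in> dir_class i" if e: "e \<in> edges G" for e
  proof -
    obtain u v where uv: "e = {u, v}" using edge_form e by blast
    then obtain i where "i < k" "f u ! i \<noteq> f v ! i" using edge_direction e by blast
    then show ?thesis using uv e by (auto simp: doubleton_in_dir_class)
  qed
  show ?thesis
  proof (intro set_eqI iffI)
    fix A assume "A \<in> theta_classes G"
    then obtain e where e: "e \<in> edges G" "A = theta G `` {e}" unfolding tc by (auto elim: quotientE)
    then obtain i where i: "i < k" "e \<in> dir_class i" using ex by blast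
    then show "A \<in> {dir_class i |i. i < k \<and> dir_class i \<noteq> {}}" using e img by blast
  next
    fix A assume "A \<in> {dir_class i |i. i < k \<and> dir_class i \<noteq> {}}"
    then obtain i e where i: "i < k" "A = dir_class i" "e \<in> dir_class i" by auto
    then have "e \<in> edges G" unfolding dir_class_def by simp
    then show "A \<in> theta_classes G" unfolding tc using i img[of e i] by (metis quotientI)
  qed
qed

text \<open>The second claim is the mirror image of \<open>clear_bit\<close>: at a tie the injection
  is onto, and its inverse sets the bit. This is the closure needed to clear a coordinate that the
  algorithm has complemented.\<close>

lemma card_bit_le:
  assumes i: "i < k"
  shows "card {w \<in> verts G. f w ! i} \<le> card {w \<in> verts G. \<not> f w ! i}"
    and "card {w \<in> verts G. f w ! i} = card {w \<in> verts G. \<not> f w ! i} \<Longrightarrow>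
      w \<in> verts G \<Longrightarrow> \<not> f w ! i \<Longrightarrow> (f w)[i := True] \<in> f ` verts G"
proof -
  let ?S1 = "{w \<in> verts G. f w ! i}" and ?S0 = "{w \<in> verts G. \<not> f w ! i}"
  let ?g = "\<lambda>u. u[i := False]"
  have fin: "finite ?S1" "finite ?S0" using finite_verts by auto
  have inj1: "inj_on f ?S1" "inj_on f ?S0" using inj_f by (auto simp: inj_on_def)
  have injg: "inj_on ?g (f ` ?S1)"
  proof (rule inj_onI)
    fix x y assume xy: "x \<in> f ` ?S1" "y \<in> f ` ?S1" "?g x = ?g y"
    then have "x ! i" "y ! i" by auto
    \<comment> \<open>The cleared bit is known to have been 1, so setting it again undoes the
      map.\<close>
    then have "x = (?g x)[i := True]" "y = (?g y)[i := True]"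
      by (metis list_update_id list_update_overwrite)+
    then show "x = y" using xy by simp
  qed
  have sub: "?g ` f ` ?S1 \<subseteq> f ` ?S0"
  proof clarify
    fix w assume w: "w \<in> verts G" "f w ! i"
    then obtain y where y: "y \<in> verts G" "f y = (f w)[i := False]" using clear_bit i by force
    then have "\<not> f y ! i" using i w by (simp add: length_f)
    then show "(f w)[i := False] \<in> f ` ?S0" using y by (metis (mono_tags, lifting) imageI mem_Collect_eq)
  qed
  have c: "card (?g ` f ` ?S1) = card ?S1" "card (f ` ?S0) = card ?S0"
    using inj1 injg by (simp_all add: card_image)
  show "card ?S1 \<le> card ?S0" using card_mono[OF _ sub] c fin by simp
  assume eq: "card ?S1 = card ?S0" and w: "w \<in> verts G" "\<not> f w ! i"
  have "?g ` f ` ?S1 = f ` ?S0" using card_subset_eq[OF _ sub] c fin eq by simp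
  then obtain y where y: "y \<in> verts G" "f y ! i" "f w = ?g (f y)"
    using w by (smt (verit) image_iff mem_Collect_eq)
  then have "(f w)[i := True] = f y" by (metis list_update_id list_update_overwrite)
  then show "(f w)[i := True] \<in> f ` verts G" using y by simp
qed

end

text \<open>Reusing the distance formula for the ambient cube turns the isometry condition of
  \<open>labelling\<close> into an equation between Hamming distances.\<close>

interpretation hypercube: daisy_graph "hypercube k" k "\<lambda>u. u" for k
proof
  show "finite (verts (hypercube k))"
    using finite_lists_length_eq[of "UNIV :: bool set" k] by (simp add: hypercube_def strings_def)
  show iff: "{u, v} \<in> edges (hypercube k) \<longleftrightarrow> hdist k u v = 1"
    if "u \<in> verts (hypercube k)" "v \<in> verts (hypercube k)" for u v
    using that hdist_commute[of k u v]
    by (auto simp: hypercube_def doubleton_eq_iff hdist_def)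
qed (auto simp: hypercube_def strings_def doubleton_eq_iff)

lemma gdist_hypercube:
  assumes "length u = k" "length v = k"
  shows "gdist (hypercube k) u v = hdist k u v"
  using assms by (intro hypercube.gdist_eq) (auto simp: hypercube_def strings_def)

lemma daisy_graph_if_is_daisy_cube:
  assumes "is_daisy_cube G"
  obtains k f where "daisy_graph G k f"
proof -
  obtain k X f where sg: "simple_graph G" and X: "X \<subseteq> strings k"
    and iso: "graph_iso f G (daisy_cube k X)"
    using assms unfolding is_daisy_cube_def by blast
  let ?S = "{u \<in> strings k. \<exists>x \<in> X. string_le u x}"
  have S: "verts (daisy_cube k X) = ?S"
    by (auto simp: daisy_cube_def induced_subgraph_def hypercube_def)
  have fS: "f ` verts G = ?S" and inj: "inj_on f (verts G)"
    using iso unfolding graph_iso_def bij_betw_def S by blast+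
  have fS_mem: "f u \<in> ?S" if "u \<in> verts G" for u using imageI[OF that, of f] unfolding fS .
  have sub: "edges G \<subseteq> {{u, v} | u v. u \<in> verts G \<and> v \<in> verts G \<and> u \<noteq> v}" and fin: "finite (verts G)"
    using sg unfolding simple_graph_def by blast+
  have "daisy_graph G k f"
  proof
    show "finite (verts G)" by (rule fin)
    show "\<exists>u v. e = {u, v}" if "e \<in> edges G" for e
      using subsetD[OF sub that] by auto
    show "u \<in> verts G \<and> v \<in> verts G" if "{u, v} \<in> edges G" for u v
      using subsetD[OF sub that] by (auto simp: doubleton_eq_iff)
    show "inj_on f (verts G)" by (rule inj)
    show len: "length (f u) = k" if "u \<in> verts G" for u
      using fS_mem[OF that] unfolding strings_def by simp
    show "(f u)[i := False] \<in> f ` verts G" if u: "u \<in> verts G" and i: "i < k" for u i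
    proof -
      \<comment> \<open>Clearing a bit keeps a string below the same generator
        \<open>x\<close>.\<close>
      obtain x where "x \<in> X" "string_le (f u) x" using fS_mem[OF u] by blast
      then have "string_le ((f u)[i := False]) x"
        using i len[OF u] unfolding string_le_def list_all2_conv_all_nth
        by (auto simp: nth_list_update)
      then show ?thesis unfolding fS using \<open>x \<in> X\<close> len[OF u] by (auto simp: strings_def)
    qed
    show "{u, v} \<in> edges G \<longleftrightarrow> hdist k (f u) (f v) = 1" if uv: "u \<in> verts G" "v \<in> verts G" for u v
    proof -
      note fuv = fS_mem[OF uv(1)] fS_mem[OF uv(2)]
      then have "{f u, f v} \<in> edges (daisy_cube k X) \<longleftrightarrow> {f u, f v} \<in> edges (hypercube k)"
        by (auto simp: daisy_cube_def induced_subgraph_def)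
      also have "\<dots> \<longleftrightarrow> hdist k (f u) (f v) = 1"
        using fuv by (intro hypercube.edge_iff) (auto simp: hypercube_def)
      finally show ?thesis using iso uv unfolding graph_iso_def by simp
    qed
  qed
  then show ?thesis by (rule that)
qed

section \<open>Correctness of the labelling\<close>

context daisy_graph
begin

text \<open>The flag \<open>c\<close> records whether the output bit is the complement of the
  \<open>i\<close>-th bit of \<open>f\<close>. Complementation comes with its licence: it happens
  only at a tie, where the set of labels is also closed under setting bit \<open>i\<close>.\<close>

lemma algorithm_output_coordinate:
  assumes out: "algorithm_output G \<Theta>s \<phi>" and j: "j < length \<Theta>s"
  obtains i c where "i < k" "\<Theta>s ! j = dir_class i"
    "\<And>w. w \<in> verts G \<Longrightarrow> \<phi> w ! j \<longleftrightarrow> f w ! i \<noteq> c"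
    "\<And>w. w \<in> verts G \<Longrightarrow> c \<Longrightarrow> \<not> f w ! i \<Longrightarrow> (f w)[i := True] \<in> f ` verts G"
proof -
  obtain a b where ab: "{a, b} \<in> \<Theta>s ! j" and bits:
    "if card (W G a b) \<ge> card (W G b a)
     then (\<forall>w \<in> W G a b. \<phi> w ! j = False) \<and> (\<forall>w \<in> W G b a. \<phi> w ! j = True)
     else (\<forall>w \<in> W G b a. \<phi> w ! j = False) \<and> (\<forall>w \<in> W G a b. \<phi> w ! j = True)"
    using out j unfolding algorithm_output_def by blast
  have "\<Theta>s ! j \<in> theta_classes G" using out j unfolding algorithm_output_def by force
  then obtain i where i: "i < k" "\<Theta>s ! j = dir_class i" unfolding theta_classes_eq by auto
  have e: "{a, b} \<in> edges G" "{b, a} \<in> edges G" "f a ! i \<noteq> f b ! i" "f b ! i \<noteq> f a ! i"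
    using ab i by (auto simp: doubleton_in_dir_class insert_commute)
  let ?S1 = "{w \<in> verts G. f w ! i}" and ?S0 = "{w \<in> verts G. \<not> f w ! i}"
  have W: "W G a b = (if f a ! i then ?S1 else ?S0)" "W G b a = (if f a ! i then ?S0 else ?S1)"
    using W_edge[OF e(1) i(1) e(3)] W_edge[OF e(2) i(1) e(4)] e(3) by auto
  note le = card_bit_le[OF i(1)]
  show ?thesis
  \<comment> \<open>The larger side receives 0, and at a tie the side of \<open>a\<close> does. The
    strings with bit 1 are never in the majority, so they can receive 0 only if \<open>a\<close> is
    one of them and the sides are equal.\<close>
  proof (cases "f a ! i \<and> card ?S1 \<ge> card ?S0")
    case True
    then have "card ?S1 = card ?S0" using le(1) by simp
    show ?thesis
    proof (rule that[of i True, OF i])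
      show "\<phi> w ! j \<longleftrightarrow> f w ! i \<noteq> True" if "w \<in> verts G" for w
        using bits True W that by (cases "f w ! i") auto
      show "(f w)[i := True] \<in> f ` verts G" if "w \<in> verts G" "\<not> f w ! i" for w
        using le(2) \<open>card ?S1 = card ?S0\<close> that by blast
    qed
  next
    case False
    show ?thesis
    proof (rule that[of i False, OF i])
      show "\<phi> w ! j \<longleftrightarrow> f w ! i \<noteq> False" if "w \<in> verts G" for w
        using bits False W that le(1) by (cases "f w ! i"; cases "f a ! i") auto
    qed simp
  qed
qed

text \<open>The output coordinates correspond injectively, via \<open>\<sigma>\<close>, to
  coordinates of \<open>f\<close>, and every coordinate in which two labels of \<open>f\<close>
  differ is hit. Complementing a bit in all labels does not affect where two labels differ, so
  Hamming distances are preserved. Downward closure is checked bit by bit.\<close>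

lemma proper_labelling_if_algorithm_output:
  assumes out: "algorithm_output G \<Theta>s \<phi>"
  shows "proper_labelling G (length \<Theta>s) \<phi>"
proof -
  let ?K = "length \<Theta>s"
  \<comment> \<open>Packing the conclusions into one predicate lets \<open>\<sigma>\<close> and
    \<open>c\<close> be chosen simultaneously for all coordinates.\<close>
  define P where "P j i c \<longleftrightarrow> i < k \<and> \<Theta>s ! j = dir_class i \<and>
      (\<forall>w \<in> verts G. \<phi> w ! j \<longleftrightarrow> f w ! i \<noteq> c) \<and>
      (\<forall>w \<in> verts G. c \<longrightarrow> \<not> f w ! i \<longrightarrow> (f w)[i := True] \<in> f ` verts G)" for j i c
  have "\<exists>i c. P j i c" if "j < ?K" for j
    by (rule algorithm_output_coordinate[OF out that]) (unfold P_def, blast)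
  then obtain \<sigma> c where P: "\<And>j. j < ?K \<Longrightarrow> P j (\<sigma> j) (c j)" by metis
  have \<sigma>: "\<And>j. j < ?K \<Longrightarrow> \<sigma> j < k" "\<And>j. j < ?K \<Longrightarrow> \<Theta>s ! j = dir_class (\<sigma> j)"
    and \<phi>: "\<And>j w. j < ?K \<Longrightarrow> w \<in> verts G \<Longrightarrow> \<phi> w ! j \<longleftrightarrow> f w ! \<sigma> j \<noteq> c j"
    and up: "\<And>j w. j < ?K \<Longrightarrow> w \<in> verts G \<Longrightarrow> c j \<Longrightarrow> \<not> f w ! \<sigma> j \<Longrightarrow>
      (f w)[\<sigma> j := True] \<in> f ` verts G"
    using P unfolding P_def by auto
  have len: "length (\<phi> w) = ?K" if "w \<in> verts G" for w
    using out that unfolding algorithm_output_def by blast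
  have inj: "inj_on \<sigma> {..<?K}"
    using out \<sigma> unfolding algorithm_output_def inj_on_def by (metis distinct_conv_nth lessThan_iff)
  \<comment> \<open>If two labels differ in bit \<open>i\<close>, one of them has a 1 there;
    clearing it gives an edge of direction \<open>i\<close>, so this class is nonempty and is
    listed.\<close>
  have surj: "\<exists>j<?K. \<sigma> j = i" if i: "i < k" and uv: "u \<in> verts G" "v \<in> verts G" "f u ! i \<noteq> f v ! i"
    for i u v
  proof -
    obtain w where w: "w \<in> verts G" "f w ! i" using uv by blast
    then obtain y where y: "y \<in> verts G" "f y = (f w)[i := False]" using clear_bit i by force
    have "hdist k (f w) (f y) = 1" unfolding y(2) using w i by (intro hdist_flip) (auto simp: length_f)
    then have wy: "{w, y} \<in> dir_class i"
      using w y i edge_iff by (simp add: doubleton_in_dir_class length_f)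
    then have "dir_class i \<in> set \<Theta>s"
      using out i unfolding algorithm_output_def theta_classes_eq by blast
    then obtain j where "j < ?K" "\<Theta>s ! j = dir_class i" by (metis in_set_conv_nth)
    then show ?thesis using \<sigma> dir_class_disjoint wy i by metis
  qed
  have hd: "hdist ?K (\<phi> u) (\<phi> v) = hdist k (f u) (f v)" if uv: "u \<in> verts G" "v \<in> verts G" for u v
  proof -
    have "{i. i < k \<and> f u ! i \<noteq> f v ! i} = \<sigma> ` {j. j < ?K \<and> \<phi> u ! j \<noteq> \<phi> v ! j}"
    proof (intro subset_antisym subsetI)
      fix i assume i: "i \<in> {i. i < k \<and> f u ! i \<noteq> f v ! i}"
      then obtain j where j: "j < ?K" "\<sigma> j = i" using surj uv by blast
      then have "\<phi> u ! j \<noteq> \<phi> v ! j" using i \<phi>[OF j(1)] uv by auto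
      then show "i \<in> \<sigma> ` {j. j < ?K \<and> \<phi> u ! j \<noteq> \<phi> v ! j}" using j by blast
    next
      fix i assume "i \<in> \<sigma> ` {j. j < ?K \<and> \<phi> u ! j \<noteq> \<phi> v ! j}"
      then obtain j where j: "j < ?K" "\<sigma> j = i" "\<phi> u ! j \<noteq> \<phi> v ! j" by blast
      then show "i \<in> {i. i < k \<and> f u ! i \<noteq> f v ! i}" using \<sigma>(1)[OF j(1)] \<phi>[OF j(1)] uv by auto
    qed
    moreover have "inj_on \<sigma> {j. j < ?K \<and> \<phi> u ! j \<noteq> \<phi> v ! j}"
      using inj by (rule inj_on_subset) auto
    ultimately show ?thesis unfolding hdist_def by (simp add: card_image)
  qed
  have lab: "labelling G ?K \<phi>"
    unfolding labelling_def using hd len by (auto simp: strings_def gdist_hypercube gdist_eq)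
  \<comment> \<open>An output bit 1 means that bit \<open>\<sigma> j\<close> of \<open>f x\<close>
    is the negation of \<open>c j\<close>. Turning it into \<open>c j\<close> is a clearing if
    \<open>c j\<close> is false, and a setting, allowed by \<open>up\<close>, if \<open>c j\<close>
    is true.\<close>
  have step: "p[j := False] \<in> \<phi> ` verts G" if p: "p \<in> \<phi> ` verts G" and j: "j < ?K" "p ! j" for p j
  proof -
    obtain x where x: "x \<in> verts G" "p = \<phi> x" using p by auto
    have "(f x)[\<sigma> j := c j] \<in> f ` verts G"
      using \<phi>[OF j(1) x(1)] up[OF j(1) x(1)] clear_bit[OF x(1) \<sigma>(1)[OF j(1)]] j x by (cases "c j") auto
    then obtain y where y: "y \<in> verts G" "f y = (f x)[\<sigma> j := c j]" by auto
    have "p[j := False] = \<phi> y"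
    proof (rule nth_equalityI)
      show "length (p[j := False]) = length (\<phi> y)" using x y len by simp
      fix l assume "l < length (p[j := False])"
      then have l: "l < ?K" using x len by simp
      show "p[j := False] ! l = \<phi> y ! l"
      proof (cases "l = j")
        case True
        then show ?thesis using \<phi>[OF l y(1)] y x j len \<sigma>(1) by (simp add: length_f)
      next
        case False
        then have "\<sigma> l \<noteq> \<sigma> j" using inj l j by (auto simp: inj_on_def)
        then show ?thesis using False \<phi>[OF l y(1)] \<phi>[OF l x(1)] y x by simp
      qed
    qed
    then show ?thesis using y by simp
  qed
  \<comment> \<open>Only single bits can be cleared so far, hence the induction on the Hamming
    distance from \<open>x\<close> down to \<open>u\<close>: each bit in which they differ is 1 in
    \<open>x\<close>.\<close>
  have "u \<in> \<phi> ` verts G"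
    if "x \<in> \<phi> ` verts G" "u \<in> strings ?K" "string_le u x" "hdist ?K x u = d" for x u d
    using that
  proof (induction d arbitrary: x)
    case 0
    then have "x = u" using len by (intro hdist_eq_0D[of ?K]) (auto simp: strings_def)
    then show ?case using 0 by simp
  next
    case (Suc d)
    have lx: "length x = ?K" "length u = ?K" using Suc.prems len by (auto simp: strings_def)
    have "{j. j < ?K \<and> x ! j \<noteq> u ! j} \<noteq> {}"
      using Suc.prems(4) unfolding hdist_def by (metis card.empty nat.distinct(1))
    then obtain j where j: "j < ?K" "x ! j \<noteq> u ! j" by auto
    then have xj: "x ! j" "\<not> u ! j"
      using Suc.prems(3) lx unfolding string_le_def list_all2_conv_all_nth by auto
    have "hdist ?K (x[j := False]) u = d"
      using hdist_agree[of j ?K x u] j xj lx Suc.prems(4) by simp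
    moreover have "string_le u (x[j := False])"
      using Suc.prems(3) xj j(1) lx unfolding string_le_def list_all2_conv_all_nth
      by (auto simp: nth_list_update)
    ultimately show ?case using Suc.IH[OF step[OF Suc.prems(1) j(1) xj(1)]] Suc.prems(2) by blast
  qed
  then show ?thesis using lab unfolding proper_labelling_def by blast
qed

end

section \<open>Reasoning about running times\<close>

text \<open>Total correctness with a time bound. As execution is deterministic, one halting run
  within the bound speaks for all runs.\<close>

definition runs :: "com \<Rightarrow> memory \<Rightarrow> nat \<Rightarrow> (memory \<Rightarrow> bool) \<Rightarrow> bool" where
  "runs c s T Q \<longleftrightarrow> (\<exists>t s'. exec c s t s' \<and> t \<le> T \<and> Q s')"

lemma runs_mono:
  assumes "runs c s T Q" "T \<le> T'" "\<And>s'. Q s' \<Longrightarrow> Q' s'"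
  shows "runs c s T' Q'"
  using assms unfolding runs_def by (meson le_trans)

lemma runs_Seq:
  assumes "runs c s T R" "\<And>s'. R s' \<Longrightarrow> runs d s' T' Q" "T + T' \<le> T''"
  shows "runs (Seq c d) s T'' Q"
proof -
  obtain t s' where 1: "exec c s t s'" "t \<le> T" "R s'" using assms(1) unfolding runs_def by blast
  then obtain t' s'' where 2: "exec d s' t' s''" "t' \<le> T'" "Q s''"
    using assms(2) unfolding runs_def by blast
  have "exec (Seq c d) s (t + t') s''" using 1 2 by (blast intro: exec_Seq)
  moreover have "t + t' \<le> T''" using 1 2 assms(3) by linarith
  ultimately show ?thesis using 2 unfolding runs_def by blast
qed

lemma runs_Cond:
  assumes "bval p s \<Longrightarrow> runs c s T Q" "\<not> bval p s \<Longrightarrow> runs d s T Q" "bcost p + T + 1 \<le> T'"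
  shows "runs (Cond p c d) s T' Q"
proof (cases "bval p s")
  case True
  then obtain t s' where "exec c s t s'" "t \<le> T" "Q s'" using assms(1) unfolding runs_def by blast
  then have "exec (Cond p c d) s (bcost p + t + 1) s'" "bcost p + t + 1 \<le> T'" "Q s'"
    using True exec_Cond_True assms(3) by fastforce+
  then show ?thesis unfolding runs_def by blast
next
  case False
  then obtain t s' where "exec d s t s'" "t \<le> T" "Q s'" using assms(2) unfolding runs_def by blast
  then have "exec (Cond p c d) s (bcost p + t + 1) s'" "bcost p + t + 1 \<le> T'" "Q s'"
    using False exec_Cond_False assms(3) by fastforce+
  then show ?thesis unfolding runs_def by blast
qed

text \<open>The potential \<open>\<Phi>\<close> pays for the remaining iterations, and so also shows termination.\<close>

lemma runs_Loop:
  assumes "I s"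
    and step: "\<And>s. I s \<Longrightarrow> bval p s \<Longrightarrow>
      \<exists>T. runs c s T (\<lambda>s'. I s' \<and> bcost p + T + 1 + \<Phi> s' \<le> \<Phi> s)"
  shows "runs (Loop p c) s (\<Phi> s + bcost p + 1) (\<lambda>s'. I s' \<and> \<not> bval p s')"
  using assms(1)
proof (induction "\<Phi> s" arbitrary: s rule: less_induct)
  case less
  show ?case
  proof (cases "bval p s")
    case False
    then have "exec (Loop p c) s (bcost p + 1) s" by (rule exec_Loop_False)
    then show ?thesis using False less.prems unfolding runs_def by force
  next
    case True
    then obtain T t s' where s': "exec c s t s'" "t \<le> T" "I s'" "bcost p + T + 1 + \<Phi> s' \<le> \<Phi> s"
      using step[OF less.prems True] unfolding runs_def by blast
    then obtain t' s'' where s'': "exec (Loop p c) s' t' s''" "t' \<le> \<Phi> s' + bcost p + 1"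
      "I s''" "\<not> bval p s''"
      using less.hyps[of s'] unfolding runs_def by auto
    have "exec (Loop p c) s (bcost p + t + t' + 1) s''"
      using True s'(1) s''(1) by (rule exec_Loop_True)
    moreover have "bcost p + t + t' + 1 \<le> \<Phi> s + bcost p + 1" using s' s'' by linarith
    ultimately show ?thesis using s'' unfolding runs_def by blast
  qed
qed

section \<open>Frame rule for arrays that a command does not write\<close>

primrec mods :: "com \<Rightarrow> array set" where
  "mods Skip = {}"
| "mods (Store x e f) = {x}"
| "mods (Seq c d) = mods c \<union> mods d"
| "mods (Cond p c d) = mods c \<union> mods d"
| "mods (Loop p c) = mods c"

lemma exec_mods: "exec c s t s' \<Longrightarrow> y \<notin> mods c \<Longrightarrow> s' y = s y"
  by (induction rule: exec.induct) auto

definition agree_off :: "array set \<Rightarrow> memory \<Rightarrow> memory \<Rightarrow> bool" where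
  "agree_off Y s s' \<longleftrightarrow> (\<forall>y. y \<notin> Y \<longrightarrow> s' y = s y)"

lemma agree_offD: "agree_off Y s s' \<Longrightarrow> y \<notin> Y \<Longrightarrow> s' y = s y"
  by (simp add: agree_off_def)

lemma runs_frame:
  "runs c s T Q \<Longrightarrow> runs c s T (\<lambda>s'. Q s' \<and> agree_off (mods c) s s')"
  unfolding runs_def agree_off_def using exec_mods by blast

lemma runs_Seq_frame:
  assumes "runs c s T R" "\<And>s'. R s' \<Longrightarrow> agree_off (mods c) s s' \<Longrightarrow> runs d s' T' Q" "T + T' \<le> T''"
  shows "runs (Seq c d) s T'' Q"
  using runs_Seq[OF runs_frame[OF assms(1)]] assms(2,3) by blast

section \<open>Symbolic execution of loop-free commands\<close>

primrec loop_free :: "com \<Rightarrow> bool" where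
  "loop_free Skip \<longleftrightarrow> True"
| "loop_free (Store x e f) \<longleftrightarrow> True"
| "loop_free (Seq c d) \<longleftrightarrow> loop_free c \<and> loop_free d"
| "loop_free (Cond p c d) \<longleftrightarrow> loop_free c \<and> loop_free d"
| "loop_free (Loop p c) \<longleftrightarrow> False"

text \<open>The value at \<open>Loop\<close> is a dummy here and in \<open>effect\<close>; both
  functions are meaningful only for loop-free commands.\<close>

primrec worst_cost :: "com \<Rightarrow> nat" where
  "worst_cost Skip = 1"
| "worst_cost (Store x e f) = acost e + acost f + 1"
| "worst_cost (Seq c d) = worst_cost c + worst_cost d"
| "worst_cost (Cond p c d) = bcost p + max (worst_cost c) (worst_cost d) + 1"
| "worst_cost (Loop p c) = 0"

primrec effect :: "com \<Rightarrow> memory \<Rightarrow> memory" where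
  "effect Skip s = s"
| "effect (Store x e f) s = s(x := (s x)(aval e s := aval f s))"
| "effect (Seq c d) s = effect d (effect c s)"
| "effect (Cond p c d) s = (if bval p s then effect c s else effect d s)"
| "effect (Loop p c) s = s"

lemma runs_effect: "loop_free c \<Longrightarrow> runs c s (worst_cost c) (\<lambda>s'. s' = effect c s)"
proof (induction c arbitrary: s)
  case Skip
  then show ?case using exec_Skip[of s] by (auto simp: runs_def)
next
  case (Store x e f)
  then show ?case unfolding runs_def effect.simps worst_cost.simps using exec_Store[of x e f s] le_refl by blast
next
  case (Seq c d)
  then show ?case by (intro runs_Seq[where R = "\<lambda>s'. s' = effect c s"]) auto
next
  case (Cond p c d)
  let ?T = "max (worst_cost c) (worst_cost d)"
  have "runs c s ?T (\<lambda>s'. s' = effect c s)" "runs d s ?T (\<lambda>s'. s' = effect d s)"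
    using Cond by (force intro: runs_mono[OF Cond.IH(1)] runs_mono[OF Cond.IH(2)])+
  then show ?case by (intro runs_Cond[where T = ?T]) auto
qed simp

lemma runs_loop_free:
  assumes "loop_free c" "worst_cost c \<le> T" "Q (effect c s)"
  shows "runs c s T Q"
  using runs_mono[OF runs_effect[OF assms(1)] assms(2)] assms(3) by blast

lemma runs_loop_free_Seq:
  assumes "loop_free c" "runs d (effect c s) T Q"
  shows "runs (Seq c d) s (worst_cost c + T) Q"
  using runs_effect[OF assms(1)] assms(2) by (auto intro: runs_Seq)

lemma incr_simps [simp]:
  "mods (incr x) = {x}" "loop_free (incr x)" "worst_cost (incr x) = 6"
  "effect (incr x) s = s(x := (s x)(0 := Suc (s x 0)))"
  by (auto simp: incr_def)

lemma mods_for_loop [simp]: "mods (for_loop x lo hi c) = insert x (mods c)"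
  by (auto simp: for_loop_def)

text \<open>The bound \<open>B i\<close> may vary with the iteration, which lets the costs of
  scanning adjacency lists add up to the sum of the degrees. The limit \<open>hi\<close> is
  evaluated anew in every round, hence the demand that it be stable under all changes the loop can
  make. Per round, the test costs \<open>acost hi + 3\<close>, the loop rule 1 and the increment 6;
  the 6 outside the sum covers the initial assignment and the last, failing test.\<close>

lemma runs_for_loop:
  assumes lo: "aval lo s = l" "l \<le> N"
    and hi: "\<And>s'. agree_off (insert x (mods c)) s s' \<Longrightarrow> aval hi s' = N"
    and init: "I l (s(x := (s x)(0 := l)))"
    and body: "\<And>i s'. \<lbrakk>l \<le> i; i < N; agree_off (insert x (mods c)) s s'; s' x 0 = i; I i s'\<rbrakk> \<Longrightarrow>
      runs c s' (B i) (\<lambda>s''. s'' x 0 = i \<and> I (Suc i) (s''(x := (s'' x)(0 := Suc i))))"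
    and T: "acost lo + acost hi + 6 + (\<Sum>i=l..<N. B i + acost hi + 10) \<le> T"
  shows "runs (for_loop x lo hi c) s T
    (\<lambda>s'. I N s' \<and> s' x 0 = N \<and> agree_off (insert x (mods c)) s s')"
proof -
  let ?Y = "insert x (mods c)" and ?p = "\<^bold>!x \<^bold>< hi"
  let ?s0 = "s(x := (s x)(0 := l))"
  define \<Phi> where "\<Phi> s' = (\<Sum>i=s' x 0..<N. B i + acost hi + 10)" for s' :: memory
  define J where "J s' \<longleftrightarrow> agree_off ?Y s s' \<and> l \<le> s' x 0 \<and> s' x 0 \<le> N \<and> I (s' x 0) s'" for s'
  have J0: "J ?s0" using lo init by (auto simp: J_def agree_off_def)
  have "runs (Loop ?p (c ;; incr x)) ?s0 (\<Phi> ?s0 + bcost ?p + 1) (\<lambda>s'. J s' \<and> \<not> bval ?p s')"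
    using J0
  proof (rule runs_Loop[where I = J and \<Phi> = \<Phi>])
    fix s' assume J: "J s'" and b: "bval ?p s'"
    define i where "i = s' x 0"
    have i: "i < N" "l \<le> i" "agree_off ?Y s s'" "I i s'"
      using J b hi by (auto simp: J_def i_def)
    have "runs (c ;; incr x) s' (B i + 6) (\<lambda>s''. J s'' \<and> s'' x 0 = Suc i)"
    proof (rule runs_Seq_frame)
      show "runs c s' (B i) (\<lambda>s1. s1 x 0 = i \<and> I (Suc i) (s1(x := (s1 x)(0 := Suc i))))"
        by (rule body) (use i in \<open>simp_all add: i_def\<close>)
    next
      fix s1 assume s1: "s1 x 0 = i \<and> I (Suc i) (s1(x := (s1 x)(0 := Suc i)))"
        and fr: "agree_off (mods c) s' s1"
      have "agree_off ?Y s (s1(x := (s1 x)(0 := Suc i)))"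
        using fr i(3) by (auto simp: agree_off_def)
      then show "runs (incr x) s1 6 (\<lambda>s''. J s'' \<and> s'' x 0 = Suc i)"
        using s1 i by (intro runs_loop_free) (auto simp: J_def)
    qed simp
    moreover have "bcost ?p + (B i + 6) + 1 + \<Phi> s'' \<le> \<Phi> s'" if "s'' x 0 = Suc i" for s''
      using i(1) that by (simp add: \<Phi>_def i_def[symmetric] sum.atLeast_Suc_lessThan)
    ultimately show "\<exists>T. runs (c ;; incr x) s' T (\<lambda>s''. J s'' \<and> bcost ?p + T + 1 + \<Phi> s'' \<le> \<Phi> s')"
      by (intro exI[of _ "B i + 6"]) (auto elim: runs_mono)
  qed
  then have loop: "runs (Loop ?p (c ;; incr x)) ?s0 (\<Phi> ?s0 + bcost ?p + 1)
      (\<lambda>s'. I N s' \<and> s' x 0 = N \<and> agree_off ?Y s s')"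
  proof (rule runs_mono)
    fix s' assume s': "J s' \<and> \<not> bval ?p s'"
    then have "s' x 0 = N" using hi by (auto simp: J_def)
    then show "I N s' \<and> s' x 0 = N \<and> agree_off ?Y s s'" using s' by (auto simp: J_def)
  qed simp
  have "runs (x :== lo) s (acost lo + 2) (\<lambda>s'. s' = ?s0)"
    using lo by (intro runs_loop_free) auto
  then show ?thesis unfolding for_loop_def
  proof (rule runs_Seq)
    show "runs (Loop ?p (c ;; incr x)) s' (\<Phi> ?s0 + bcost ?p + 1)
      (\<lambda>s'. I N s' \<and> s' x 0 = N \<and> agree_off ?Y s s')" if "s' = ?s0" for s'
      using loop that by simp
  qed (use T in \<open>simp add: \<Phi>_def\<close>)
qed

section \<open>Graphs given by adjacency lists\<close>

context daisy_graph
begin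

section \<open>Shortest walks and the range of distances\<close>

lemma gdist_self [simp]: "r \<in> verts G \<Longrightarrow> gdist G r r = 0"
  by (simp add: gdist_eq)

lemma gdist_edge_le:
  assumes "r \<in> verts G" "{u, v} \<in> edges G"
  shows "gdist G r v \<le> Suc (gdist G r u)"
proof -
  have uv: "u \<in> verts G" "v \<in> verts G" using edge_verts[OF assms(2)] by auto
  then have "hdist k (f u) (f v) = 1" using edge_iff assms(2) by blast
  then show ?thesis
    using hdist_triangle[of k "f r" "f v" "f u"] uv assms(1) by (simp add: gdist_eq)
qed

text \<open>The last vertex but one on a shortest walk. The inductions on distance in the analysis
  of the search descend along it.\<close>

lemma gdist_predecessor:
  assumes r: "r \<in> verts G" and v: "v \<in> verts G" and "v \<noteq> r"
  obtains p where "p \<in> verts G" "{p, v} \<in> edges G" "gdist G r v = Suc (gdist G r p)"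
proof -
  have walk: "(r, v) \<in> adj_rel ^^ gdist G r v" using walk_of_hdist r v by (simp add: gdist_eq)
  obtain m where m: "gdist G r v = Suc m"
    using walk \<open>v \<noteq> r\<close> by (cases "gdist G r v") auto
  then obtain p where p: "(r, p) \<in> adj_rel ^^ m" "{p, v} \<in> edges G" using walk by auto
  have pv: "p \<in> verts G" using edge_verts[OF p(2)] by simp
  have "gdist G r p \<le> m" using hdist_le_walk[OF p(1) r] r pv by (simp add: gdist_eq)
  then have "gdist G r v = Suc (gdist G r p)" using gdist_edge_le[OF r p(2)] m by linarith
  then show ?thesis using that pv p(2) by blast
qed

text \<open>All values from 0 up to a distance from \<open>r\<close> are attained as distances from
  \<open>r\<close>, and there are at most as many values as vertices. So the number of vertices can
  serve as the mark of an unreached vertex.\<close>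

lemma gdist_less_card:
  assumes r: "r \<in> verts G" and v: "v \<in> verts G"
  shows "gdist G r v < card (verts G)"
proof -
  have "{..gdist G r v} \<subseteq> gdist G r ` verts G" if "v \<in> verts G" "gdist G r v = m" for v m
    using that
  proof (induction m arbitrary: v)
    case 0
    then show ?case by force
  next
    case (Suc m)
    then have "v \<noteq> r" using r by auto
    then obtain p where p: "p \<in> verts G" "gdist G r v = Suc (gdist G r p)"
      using gdist_predecessor[OF r Suc.prems(1)] by blast
    then have "{..gdist G r p} \<subseteq> gdist G r ` verts G" using Suc by simp
    moreover have "{..gdist G r v} = insert (gdist G r v) {..gdist G r p}"
      unfolding p(2) by auto
    ultimately show ?case using Suc.prems(1) by simp
  qed
  then have "card {..gdist G r v} \<le> card (gdist G r ` verts G)"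
    using v finite_verts by (intro card_mono) auto
  also have "\<dots> \<le> card (verts G)" using finite_verts by (rule card_image_le)
  finally show ?thesis by simp
qed

lemma exists_neighbour:
  assumes "u \<in> verts G" "v \<in> verts G" "u \<noteq> v"
  shows "\<exists>w. {u, w} \<in> edges G"
  by (rule gdist_predecessor[OF assms(2,1,3)]) (auto simp: insert_commute)

end

text \<open>The input arrays are frozen as functions, so that facts about arcs do not refer to a
  memory state; the cells \<open>off v..<off (Suc v)\<close> hold the arcs leaving
  \<open>v\<close>.\<close>

locale daisy_input = daisy_graph G k f for G :: "nat sgraph" and k f +
  fixes n :: nat and off adj :: "nat \<Rightarrow> nat"
  assumes verts_eq: "verts G = {..<n}"
    and off_0: "off 0 = 0"
    and off_Suc: "v < n \<Longrightarrow> off v \<le> off (Suc v)"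
    and adj_inj: "v < n \<Longrightarrow> inj_on adj {off v..<off (Suc v)}"
    and adj_image: "v < n \<Longrightarrow> adj ` {off v..<off (Suc v)} = {w. {v, w} \<in> edges G}"
begin

section \<open>Arcs, their tails and their number\<close>

abbreviation num_arc :: nat where "num_arc \<equiv> off n"

text \<open>The vertex whose list contains cell \<open>j\<close>. The least index is the right one
  because \<open>off\<close> is known to be monotone up to \<open>n\<close> only and is arbitrary
  beyond.\<close>

definition tail_of :: "nat \<Rightarrow> nat" where
  "tail_of j = (LEAST v. j < off (Suc v))"

lemma off_mono: "u \<le> v \<Longrightarrow> v \<le> n \<Longrightarrow> off u \<le> off v"
proof (induction rule: dec_induct)
  case (step m)
  then show ?case using off_Suc[of m] by simp
qed simp

lemma tail_of_eq:
  assumes "v < n" "off v \<le> j" "j < off (Suc v)"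
  shows "tail_of j = v"
  unfolding tail_of_def
proof (rule Least_equality)
  fix u assume "j < off (Suc u)"
  then have "\<not> off (Suc u) \<le> off v" using assms by linarith
  then show "v \<le> u" using off_mono[of "Suc u" v] assms(1) by linarith
qed (use assms in simp)

lemma tail_of:
  assumes "j < num_arc"
  shows "tail_of j < n" "off (tail_of j) \<le> j" "j < off (Suc (tail_of j))"
proof -
  obtain m where m: "n = Suc m" using assms off_0 by (cases n) auto
  then show 1: "j < off (Suc (tail_of j))" unfolding tail_of_def using assms LeastI[of "\<lambda>v. j < off (Suc v)" m] by simp
  have "tail_of j \<le> m" unfolding tail_of_def using assms m by (intro Least_le) simp
  then show "tail_of j < n" using m by simp
  show "off (tail_of j) \<le> j"
  proof (cases "tail_of j")
    case 0
    then show ?thesis by (simp add: off_0)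
  next
    case (Suc t)
    then have "\<not> j < off (Suc t)" using not_less_Least[of t "\<lambda>v. j < off (Suc v)"] by (simp add: tail_of_def)
    then show ?thesis using Suc by simp
  qed
qed

lemma arc_edge:
  assumes "j < num_arc"
  shows "{tail_of j, adj j} \<in> edges G"
proof -
  have "j \<in> {off (tail_of j)..<off (Suc (tail_of j))}" using tail_of[OF assms] by simp
  then have "adj j \<in> {w. {tail_of j, w} \<in> edges G}"
    using adj_image[OF tail_of(1)[OF assms]] by blast
  then show ?thesis by simp
qed

lemma adj_less: "j < num_arc \<Longrightarrow> adj j < n"
  using edge_verts[OF arc_edge, of j] verts_eq by simp

lemma edge_arc:
  assumes "{u, v} \<in> edges G"
  obtains j where "j < num_arc" "tail_of j = u" "adj j = v"
proof -
  have u: "u < n" using edge_verts[OF assms] verts_eq by auto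
  have "v \<in> adj ` {off u..<off (Suc u)}" unfolding adj_image[OF u] using assms by simp
  then obtain j where "j \<in> {off u..<off (Suc u)}" "adj j = v" by blast
  moreover have "off (Suc u) \<le> off n" using off_mono[of "Suc u" n] u by simp
  ultimately show ?thesis using tail_of_eq[OF u, of j] by (intro that[of j]) auto
qed

lemma sum_degrees: "m \<le> n \<Longrightarrow> (\<Sum>v<m. off (Suc v) - off v) = off m"
proof (induction m)
  case (Suc m)
  then show ?case using off_Suc[of m] by simp
qed (simp add: off_0)

text \<open>An arc is determined by its ordered pair of ends, since lists do not repeat, and an edge
  has at most two orderings of its ends.\<close>

lemma num_arc_le: "num_arc \<le> 2 * card (edges G)"
proof -
  have fE: "finite (edges G)"
  proof (rule finite_subset)
    show "edges G \<subseteq> Pow (verts G)"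
    proof
      fix e assume e: "e \<in> edges G"
      obtain u v where "e = {u, v}" using edge_form[OF e] by blast
      then show "e \<in> Pow (verts G)" using e edge_verts[of u v] by simp
    qed
  qed (simp add: finite_verts)
  have "inj_on (\<lambda>j. (tail_of j, adj j)) {..<num_arc}"
  proof (rule inj_onI)
    fix i j assume ij: "i \<in> {..<num_arc}" "j \<in> {..<num_arc}" "(tail_of i, adj i) = (tail_of j, adj j)"
    then have "i < num_arc" "j < num_arc" "tail_of j = tail_of i" "adj i = adj j" by auto
    then show "i = j"
      using tail_of[of i] tail_of(2,3)[of j] by (auto intro!: inj_onD[OF adj_inj[of "tail_of i"], of i j])
  qed
  then have "num_arc = card ((\<lambda>j. (tail_of j, adj j)) ` {..<num_arc})" by (simp add: card_image)
  also have "\<dots> \<le> card (\<Union>e\<in>edges G. {(u, v). {u, v} = e})"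
  proof (rule card_mono)
    have "(\<Union>e\<in>edges G. {(u, v). {u, v} = e}) \<subseteq> verts G \<times> verts G"
      using edge_verts by blast
    then show "finite (\<Union>e\<in>edges G. {(u, v). {u, v} = e})"
      by (rule finite_subset) (simp add: finite_verts)
    show "(\<lambda>j. (tail_of j, adj j)) ` {..<num_arc} \<subseteq> (\<Union>e\<in>edges G. {(u, v). {u, v} = e})"
      using arc_edge by blast
  qed
  also have "\<dots> \<le> (\<Sum>e\<in>edges G. card {(u, v). {u, v} = e})" using fE by (rule card_UN_le)
  also have "\<dots> \<le> (\<Sum>e\<in>edges G. 2)"
  proof (rule sum_mono)
    fix e assume e: "e \<in> edges G"
    obtain a b where "e = {a, b}" using edge_form[OF e] by blast
    then have "{(u, v). {u, v} = e} \<subseteq> {(a, b), (b, a)}" by (auto simp: doubleton_eq_iff)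
    then have "card {(u, v). {u, v} = e} \<le> card {(a, b), (b, a)}" by (intro card_mono) auto
    also have "\<dots> \<le> 2" using card_insert_le_m1[of 2 "{(b, a)}" "(a, b)"] by simp
    finally show "card {(u, v). {u, v} = e} \<le> 2" .
  qed
  finally show ?thesis by simp
qed

lemma le_num_arc:
  assumes "2 \<le> n"
  shows "n \<le> num_arc"
proof -
  have "1 \<le> off (Suc v) - off v" if v: "v < n" for v
  proof -
    define u where "u = (if v = 0 then 1 else 0 :: nat)"
    then have "u < n" "u \<noteq> v" using assms by auto
    then obtain w where "{v, w} \<in> edges G" using exists_neighbour[of v u] v verts_eq by auto
    then have "{off v..<off (Suc v)} \<noteq> {}" using adj_image[OF v] by blast
    then show ?thesis by simp
  qed
  then have "(\<Sum>v<n. 1) \<le> (\<Sum>v<n. off (Suc v) - off v)" by (intro sum_mono) auto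
  then show ?thesis using sum_degrees[of n] by simp
qed

lemma num_arc_eq_0:
  assumes "n \<le> 1"
  shows "num_arc = 0"
proof (rule ccontr)
  assume "num_arc \<noteq> 0"
  then have "{tail_of 0, adj 0} \<in> edges G" "tail_of 0 < n" "adj 0 < n"
    using arc_edge tail_of(1) adj_less by auto
  moreover have "tail_of 0 = adj 0" using calculation assms by linarith
  ultimately show False using edge_iff[of "adj 0" "adj 0"] verts_eq by simp
qed

section \<open>Directions of arcs\<close>

definition dir_of :: "nat \<Rightarrow> nat" where
  "dir_of j = (SOME i. i < k \<and> f (tail_of j) ! i \<noteq> f (adj j) ! i)"

lemma dir_of:
  assumes "j < num_arc"
  shows "dir_of j < k" "f (tail_of j) ! dir_of j \<noteq> f (adj j) ! dir_of j"
proof -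
  obtain i where "i < k \<and> f (tail_of j) ! i \<noteq> f (adj j) ! i"
    using edge_direction[OF arc_edge[OF assms]] by blast
  then show "dir_of j < k" "f (tail_of j) ! dir_of j \<noteq> f (adj j) ! dir_of j"
    unfolding dir_of_def by (rule someI2; blast)+
qed

text \<open>This is the test that the program makes: after one search from each end of arc
  \<open>i\<close>, comparing two sums decides for any arc \<open>j\<close> whether it has the same
  direction.\<close>

lemma dir_of_eq_iff:
  assumes "i < num_arc" "j < num_arc"
  shows "gdist G (tail_of i) (tail_of j) + gdist G (adj i) (adj j) =
      gdist G (tail_of i) (adj j) + gdist G (adj i) (tail_of j) \<longleftrightarrow> dir_of j \<noteq> dir_of i"
proof -
  have "tail_of j \<in> verts G" "adj j \<in> verts G" using edge_verts[OF arc_edge[OF assms(2)]] by auto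
  then have "gdist G (tail_of i) (tail_of j) + gdist G (adj i) (adj j) \<noteq>
      gdist G (tail_of i) (adj j) + gdist G (adj i) (tail_of j) \<longleftrightarrow>
      f (tail_of j) ! dir_of i \<noteq> f (adj j) ! dir_of i"
    by (rule gdist_theta_iff[OF arc_edge[OF assms(1)] dir_of[OF assms(1)]])
  moreover have "f (tail_of j) ! dir_of i \<noteq> f (adj j) ! dir_of i \<longleftrightarrow> dir_of i = dir_of j"
    using edge_direction_unique[OF arc_edge dir_of, OF assms(2,2,2) dir_of(1)[OF assms(1)]]
      dir_of(2)[OF assms(2)] by auto
  ultimately show ?thesis by auto
qed

lemma dir_class_arcs:
  assumes "i < k"
  shows "dir_class i = {{tail_of j, adj j} |j. j < num_arc \<and> dir_of j = i}"
proof (intro set_eqI iffI)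
  fix e assume e: "e \<in> dir_class i"
  then obtain u v where uv: "e = {u, v}" "f u ! i \<noteq> f v ! i" "{u, v} \<in> edges G"
    unfolding dir_class_def by auto
  then obtain j where j: "j < num_arc" "tail_of j = u" "adj j = v" using edge_arc by metis
  then have "dir_of j = i"
    using edge_direction_unique[OF uv(3) assms uv(2), of "dir_of j"] dir_of[OF j(1)] by auto
  then show "e \<in> {{tail_of j, adj j} |j. j < num_arc \<and> dir_of j = i}" using uv j by auto
next
  fix e assume "e \<in> {{tail_of j, adj j} |j. j < num_arc \<and> dir_of j = i}"
  then show "e \<in> dir_class i" using arc_edge dir_of by (auto simp: doubleton_in_dir_class)
qed

text \<open>A direction \<open>i\<close> is mapped to the vertex whose label has its only 1 in position \<open>i\<close>.\<close>

lemma card_directions: "card (dir_of ` {..<num_arc}) \<le> n"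
proof -
  let ?D = "dir_of ` {..<num_arc}"
  have unit: "\<exists>w \<in> verts G. \<forall>j<k. f w ! j \<longleftrightarrow> j = i" if i: "i \<in> ?D" for i
  proof -
    obtain j where j: "j < num_arc" "i = dir_of j" using i by auto
    have "tail_of j \<in> verts G" "adj j \<in> verts G" using edge_verts[OF arc_edge[OF j(1)]] by auto
    then obtain x where x: "x \<in> verts G" "f x ! i" using dir_of(2)[OF j(1)] j by metis
    \<comment> \<open>Starting from an end that has bit \<open>i\<close>, the other 1s are cleared
      one at a time; \<open>d\<close> counts those that remain.\<close>
    have "\<exists>w \<in> verts G. \<forall>j<k. f w ! j \<longleftrightarrow> j = i"
      if "x \<in> verts G" "f x ! i" "card {j. j < k \<and> j \<noteq> i \<and> f x ! j} = d" for x d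
      using that
    proof (induction d arbitrary: x)
      case 0
      then show ?case by (intro bexI[of _ x]) auto
    next
      case (Suc d)
      then have "{j. j < k \<and> j \<noteq> i \<and> f x ! j} \<noteq> {}" by (metis card.empty nat.distinct(1))
      then obtain l where l: "l < k" "l \<noteq> i" "f x ! l" by auto
      then obtain y where y: "y \<in> verts G" "f y = (f x)[l := False]"
        using clear_bit[OF Suc.prems(1)] by force
      have "{j. j < k \<and> j \<noteq> i \<and> f x ! j} = insert l {j. j < k \<and> j \<noteq> i \<and> f y ! j}"
        using l Suc.prems(1) unfolding y(2) by (auto simp: nth_list_update length_f)
      moreover have "l \<notin> {j. j < k \<and> j \<noteq> i \<and> f y ! j}"
        using l Suc.prems(1) unfolding y(2) by (auto simp: length_f)
      ultimately have "card {j. j < k \<and> j \<noteq> i \<and> f y ! j} = d" using Suc.prems(3) by simp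
      moreover have "f y ! i" using l Suc.prems(2) unfolding y(2) by simp
      ultimately show ?case using Suc.IH y(1) by blast
    qed
    then show ?thesis using x by blast
  qed
  then obtain g where g: "\<And>i. i \<in> ?D \<Longrightarrow> g i \<in> verts G \<and> (\<forall>j<k. f (g i) ! j \<longleftrightarrow> j = i)" by metis
  have "inj_on g ?D"
  proof (rule inj_onI)
    fix a b assume ab: "a \<in> ?D" "b \<in> ?D" "g a = g b"
    then have "a < k" using dir_of by auto
    then show "a = b" using g[OF ab(1)] g[OF ab(2)] ab(3) by auto
  qed
  then have "card ?D = card (g ` ?D)" by (simp add: card_image)
  also have "\<dots> \<le> card (verts G)" using g finite_verts by (intro card_mono) auto
  finally show ?thesis by (simp add: verts_eq)
qed

end

section \<open>Breadth-first search\<close>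

context daisy_input
begin

definition holds_input :: "memory \<Rightarrow> bool" where
  "holds_input s \<longleftrightarrow> s Size 0 = n \<and> s Off = off \<and> s Adj = adj"

lemma holds_inputD:
  assumes "holds_input s"
  shows "s Size 0 = n" "s Off = off" "s Adj = adj"
  using assms by (auto simp: holds_input_def)

lemma holds_input_agree_off:
  "\<lbrakk>holds_input s; agree_off Y s s'; Size \<notin> Y; Off \<notin> Y; Adj \<notin> Y\<rbrakk> \<Longrightarrow> holds_input s'"
  by (simp add: holds_input_def agree_off_def)

lemma sum_degrees': "(\<Sum>v=0..<n. off (Suc v) - off v) = num_arc"
  using sum_degrees[of n] by (simp add: atLeast0LessThan)

lemma runs_compute_tails:
  assumes s: "holds_input s"
  shows "runs compute_tails s (30 * (n + num_arc + 1)) (\<lambda>s'. \<forall>j<num_arc. s' Tail j = tail_of j)"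
proof -
  let ?I = "\<lambda>v (s' :: memory). \<forall>j<off v. s' Tail j = tail_of j"
  let ?inner = "for_loop Arc (Off\<^bold>[\<^bold>!Vert\<^bold>]) (Off\<^bold>[\<^bold>!Vert \<^bold>+ Const 1\<^bold>]) (Tail\<^bold>[\<^bold>!Arc\<^bold>] ::= \<^bold>!Vert)"
  note sD = holds_inputD[OF s]
  have "runs compute_tails s (30 * (n + num_arc + 1))
      (\<lambda>s'. ?I n s' \<and> s' Vert 0 = n \<and> agree_off (insert Vert (mods ?inner)) s s')"
    unfolding compute_tails_def
  \<comment> \<open>The inner loop costs 14 to set up and finish and 20 per arc of \<open>v\<close>,
    so the outer sum is linear in \<open>n + num_arc\<close>.\<close>
  proof (rule runs_for_loop[where I = ?I and l = 0 and B = "\<lambda>v. 14 + 20 * (off (Suc v) - off v)"])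
    fix v s1
    assume v: "v < n" and fr: "agree_off (insert Vert (mods ?inner)) s s1"
      and s1: "s1 Vert 0 = v" and I: "?I v s1"
    have i1: "holds_input s1" using holds_input_agree_off[OF s fr] by simp
    note s1D = holds_inputD[OF i1]
    have "runs ?inner s1 (14 + 20 * (off (Suc v) - off v))
      (\<lambda>s'. (\<forall>j<off (Suc v). s' Tail j = tail_of j) \<and> s' Arc 0 = off (Suc v) \<and>
        agree_off (insert Arc (mods (Tail\<^bold>[\<^bold>!Arc\<^bold>] ::= \<^bold>!Vert))) s1 s')"
    proof (rule runs_for_loop[where I = "\<lambda>j s'. \<forall>i<j. s' Tail i = tail_of i" and l = "off v"
          and B = "\<lambda>_. 5"])
      fix j s2
      assume j: "off v \<le> j" "j < off (Suc v)" and fr: "agree_off (insert Arc (mods (Tail\<^bold>[\<^bold>!Arc\<^bold>] ::= \<^bold>!Vert))) s1 s2"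
        and s2: "s2 Arc 0 = j" "\<forall>i<j. s2 Tail i = tail_of i"
      have "s2 Vert 0 = v" using agree_offD[OF fr, of Vert] s1 by simp
      moreover have "tail_of j = v" using tail_of_eq v j by blast
      ultimately show "runs (Tail\<^bold>[\<^bold>!Arc\<^bold>] ::= \<^bold>!Vert) s2 5 (\<lambda>s3. s3 Arc 0 = j \<and>
          (\<forall>i<Suc j. (s3(Arc := (s3 Arc)(0 := Suc j))) Tail i = tail_of i))"
        using s2 by (intro runs_loop_free) (auto simp: less_Suc_eq)
    qed (use s1 s1D I off_Suc[OF v] in \<open>auto simp: agree_offD\<close>)
    then show "runs ?inner s1 (14 + 20 * (off (Suc v) - off v))
      (\<lambda>s'. s' Vert 0 = v \<and> ?I (Suc v) (s'(Vert := (s' Vert)(0 := Suc v))))"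
      by (rule runs_mono) (use s1 in \<open>auto simp: agree_offD\<close>)
  qed (use sD in \<open>auto simp: agree_offD off_0 sum.distrib sum_distrib_left[symmetric] sum_degrees'\<close>)
  then show ?thesis by (rule runs_mono) auto
qed

text \<open>Here \<open>q\<close> is the queue array and \<open>e\<close> its end. Dequeuing only
  advances the head and never overwrites a cell, so the first \<open>e\<close> cells list all
  vertices reached so far, in order of nondecreasing distance.\<close>

definition bfs_state :: "nat \<Rightarrow> (nat \<Rightarrow> nat) \<Rightarrow> nat \<Rightarrow> (nat \<Rightarrow> nat) \<Rightarrow> bool" where
  "bfs_state r q e D \<longleftrightarrow>
     r \<in> q ` {..<e} \<and> inj_on q {..<e} \<and> q ` {..<e} \<subseteq> {..<n} \<and>
     (\<forall>v<n. D v = (if v \<in> q ` {..<e} then gdist G r v else n)) \<and>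
     (\<forall>i j. i \<le> j \<longrightarrow> j < e \<longrightarrow> gdist G r (q i) \<le> gdist G r (q j))"

text \<open>The head is at \<open>h\<close>: the vertices before it have been scanned completely,
  and the unscanned part of the queue spans at most two consecutive distances.\<close>

definition bfs_outer :: "nat \<Rightarrow> (nat \<Rightarrow> nat) \<Rightarrow> nat \<Rightarrow> nat \<Rightarrow> (nat \<Rightarrow> nat) \<Rightarrow> bool" where
  "bfs_outer r q h e D \<longleftrightarrow> bfs_state r q e D \<and> h \<le> e \<and>
     (h < e \<longrightarrow> (\<forall>i<e. gdist G r (q i) \<le> Suc (gdist G r (q h)))) \<and>
     (\<forall>i<h. \<forall>v. {q i, v} \<in> edges G \<longrightarrow> v \<in> q ` {..<e})"

text \<open>The last conjunct forces an unvisited neighbour of \<open>q h\<close> to be exactly one step further away.\<close>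

definition bfs_inner :: "nat \<Rightarrow> nat \<Rightarrow> nat \<Rightarrow> (nat \<Rightarrow> nat) \<Rightarrow> nat \<Rightarrow> (nat \<Rightarrow> nat) \<Rightarrow> bool" where
  "bfs_inner r h j q e D \<longleftrightarrow> bfs_state r q e D \<and> h < e \<and>
     (\<forall>i<e. gdist G r (q i) \<le> Suc (gdist G r (q h))) \<and>
     (\<forall>i<h. \<forall>v. {q i, v} \<in> edges G \<longrightarrow> v \<in> q ` {..<e}) \<and>
     (\<forall>i. off (q h) \<le> i \<longrightarrow> i < j \<longrightarrow> adj i \<in> q ` {..<e}) \<and>
     (\<forall>v<n. gdist G r v \<le> gdist G r (q h) \<longrightarrow> v \<in> q ` {..<e})"

lemma bfs_outer_init:
  assumes "r < n" "q 0 = r" "\<forall>v<n. D v = (if v = r then 0 else n)"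
  shows "bfs_outer r q 0 (Suc 0) D"
  using assms verts_eq by (auto simp: bfs_outer_def bfs_state_def lessThan_Suc)

text \<open>What is new is the last conjunct. A vertex \<open>v\<close> no further from
  \<open>r\<close> than \<open>q h\<close> has a predecessor that is strictly closer, hence already
  queued by induction; as the queue is sorted, the predecessor stands before position
  \<open>h\<close>, so it has been scanned and \<open>v\<close> is queued.\<close>

lemma bfs_inner_if_outer:
  assumes o: "bfs_outer r q h e D" and h: "h < e" and r: "r < n"
  shows "bfs_inner r h (off (q h)) q e D"
proof -
  have st: "bfs_state r q e D" using o by (simp add: bfs_outer_def)
  have "v \<in> q ` {..<e}" if "v < n" "gdist G r v \<le> gdist G r (q h)" "gdist G r v = m" for v m
    using that
  proof (induction m arbitrary: v)
    case 0
    have "v = r"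
    proof (rule ccontr)
      assume "v \<noteq> r"
      then obtain p where "gdist G r v = Suc (gdist G r p)"
        using gdist_predecessor[of r v] r 0 verts_eq by auto
      then show False using 0 by simp
    qed
    then show ?case using st by (simp add: bfs_state_def)
  next
    case (Suc m)
    then have "v \<noteq> r" using r verts_eq by auto
    then obtain p where p: "p < n" "{p, v} \<in> edges G" "gdist G r v = Suc (gdist G r p)"
      using gdist_predecessor[of r v] r Suc.prems verts_eq by auto
    have "gdist G r p = m" "gdist G r p \<le> gdist G r (q h)" using p(3) Suc.prems(2,3) by linarith+
    then have "p \<in> q ` {..<e}" using Suc.IH p(1) by blast
    then obtain i where i: "i < e" "p = q i" by auto
    have "i < h"
    proof (rule ccontr)
      assume "\<not> i < h"
      then have "gdist G r (q h) \<le> gdist G r (q i)" using st i by (simp add: bfs_state_def)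
      then show False using p i Suc.prems by simp
    qed
    then show ?case using o p i by (auto simp: bfs_outer_def)
  qed
  then show ?thesis using o h by (auto simp: bfs_inner_def bfs_outer_def)
qed

lemma bfs_inner_step_old:
  assumes "bfs_inner r h j q e D" "D (adj j) \<noteq> n" "adj j < n"
  shows "bfs_inner r h (Suc j) q e D"
  using assms by (auto simp: bfs_inner_def bfs_state_def less_Suc_eq split: if_splits)

text \<open>The edge bounds the distance of the new vertex from above and the last conjunct of
  \<open>bfs_inner\<close> bounds it from below, so it is one more than that of \<open>q h\<close>.
  This is the maximum over the queue, so appending keeps it sorted.\<close>

lemma bfs_inner_step_new:
  assumes i: "bfs_inner r h j q e D" and n: "D (adj j) = n" and r: "r < n"
    and ed: "{q h, adj j} \<in> edges G"
  shows "bfs_inner r h (Suc j) (q(e := adj j)) (Suc e) (D(adj j := Suc (D (q h))))"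
proof -
  let ?w = "adj j" and ?d = "gdist G r" and ?u = "q h"
  let ?q = "q(e := ?w)"
  have uw: "?u < n" "?w < n" using edge_verts[OF ed] verts_eq by auto
  have h: "h < e" and st: "bfs_state r q e D" using i by (simp_all add: bfs_inner_def)
  \<comment> \<open>A queued vertex stores its true distance, which is less than
    \<open>n\<close>.\<close>
  have new: "?w \<notin> q ` {..<e}"
    using st n uw gdist_less_card[of r ?w] r verts_eq by (auto simp: bfs_state_def)
  have "\<not> ?d ?w \<le> ?d ?u" using i new uw by (auto simp: bfs_inner_def)
  then have dw: "?d ?w = Suc (?d ?u)" using gdist_edge_le[OF _ ed, of r] r verts_eq by simp
  have Du: "D ?u = ?d ?u" using st h uw by (auto simp: bfs_state_def)
  have img: "?q ` {..<Suc e} = insert ?w (q ` {..<e})" by (auto simp: lessThan_Suc)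
  have le: "?d (q i) \<le> Suc (?d ?u)" if "i < e" for i using i that by (simp add: bfs_inner_def)
  have "bfs_state r ?q (Suc e) (D(?w := Suc (D ?u)))"
    unfolding bfs_state_def img
  proof (intro conjI allI impI)
    show "r \<in> insert ?w (q ` {..<e})" using st by (simp add: bfs_state_def)
    show "inj_on ?q {..<Suc e}"
    proof -
      have "inj_on q {..<e}" using st by (simp add: bfs_state_def)
      moreover have "\<And>a. a < e \<Longrightarrow> q a \<noteq> ?w" using new by (metis imageI lessThan_iff)
      ultimately show ?thesis by (fastforce simp: inj_on_def less_Suc_eq)
    qed
    show "insert ?w (q ` {..<e}) \<subseteq> {..<n}" using st uw by (simp add: bfs_state_def)
    show "(D(?w := Suc (D ?u))) v = (if v \<in> insert ?w (q ` {..<e}) then ?d v else n)" if "v < n" for v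
      using st that dw Du by (auto simp: bfs_state_def)
    show "?d (?q a) \<le> ?d (?q b)" if "a \<le> b" "b < Suc e" for a b
    proof (cases "b = e")
      case True
      then show ?thesis using le[of a] dw that by (cases "a = e") auto
    next
      case False
      then show ?thesis using st that by (simp add: bfs_state_def)
    qed
  qed
  moreover have "?d (?q a) \<le> Suc (?d (?q h))" if "a < Suc e" for a
    using that le[of a] dw h by (cases "a = e") auto
  moreover have "v \<in> insert ?w (q ` {..<e})" if "a < h" "{?q a, v} \<in> edges G" for a v
    using i that h by (simp add: bfs_inner_def)
  moreover have "adj a \<in> insert ?w (q ` {..<e})" if "off (?q h) \<le> a" "a < Suc j" for a
    using i that h by (cases "a = j") (simp_all add: bfs_inner_def)
  moreover have "v \<in> insert ?w (q ` {..<e})" if "v < n" "?d v \<le> ?d (?q h)" for v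
    using i that h by (simp add: bfs_inner_def)
  ultimately show ?thesis unfolding bfs_inner_def img using h by simp
qed

lemma bfs_outer_if_inner:
  assumes i: "bfs_inner r h (off (Suc (q h))) q e D"
  shows "bfs_outer r q (Suc h) e D"
proof -
  have h: "h < e" and st: "bfs_state r q e D" using i by (simp_all add: bfs_inner_def)
  have u: "q h < n" using st h by (auto simp: bfs_state_def)
  have "v \<in> q ` {..<e}" if "{q h, v} \<in> edges G" for v
  proof -
    have "v \<in> adj ` {off (q h)..<off (Suc (q h))}" unfolding adj_image[OF u] using that by simp
    then obtain a where "off (q h) \<le> a" "a < off (Suc (q h))" "v = adj a" by auto
    then show ?thesis using i by (simp add: bfs_inner_def)
  qed
  moreover have "gdist G r (q a) \<le> Suc (gdist G r (q (Suc h)))" if "Suc h < e" "a < e" for a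
  proof -
    have "gdist G r (q a) \<le> Suc (gdist G r (q h))" using i that by (simp add: bfs_inner_def)
    moreover have "gdist G r (q h) \<le> gdist G r (q (Suc h))" using st that by (simp add: bfs_state_def)
    ultimately show ?thesis by simp
  qed
  ultimately show ?thesis using i st h by (auto simp: bfs_outer_def bfs_inner_def less_Suc_eq)
qed

text \<open>Once the head meets the end, the queued vertices contain \<open>r\<close> and are closed
  under taking neighbours; since every vertex is joined to \<open>r\<close> by a chain of
  predecessors, all have been reached.\<close>

lemma bfs_outer_end:
  assumes o: "bfs_outer r q e e D" and r: "r < n" and v: "v < n"
  shows "D v = gdist G r v"
proof -
  have "v \<in> q ` {..<e}" if "v < n" "gdist G r v = m" for v m
    using that
  proof (induction m arbitrary: v)
    case (Suc m)
    then have "v \<noteq> r" using r verts_eq by auto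
    then obtain p where p: "p < n" "{p, v} \<in> edges G" "gdist G r v = Suc (gdist G r p)"
      using gdist_predecessor[of r v] r Suc.prems verts_eq by auto
    have "gdist G r p = m" using p(3) Suc.prems(2) by linarith
    then have "p \<in> q ` {..<e}" using Suc.IH p(1) by blast
    then show ?case using o p by (auto simp: bfs_outer_def)
  next
    case 0
    have "v = r"
    proof (rule ccontr)
      assume "v \<noteq> r"
      then obtain p where "gdist G r v = Suc (gdist G r p)"
        using gdist_predecessor[of r v] r 0 verts_eq by auto
      then show False using 0 by simp
    qed
    then show ?case using o by (simp add: bfs_outer_def bfs_state_def)
  qed
  then show ?thesis using o v by (simp add: bfs_outer_def bfs_state_def)
qed

section \<open>Execution of the search\<close>

abbreviation scan_arc :: "array \<Rightarrow> com" where
  "scan_arc D \<equiv>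
     IF D\<^bold>[Adj\<^bold>[\<^bold>!Arc\<^bold>]\<^bold>] \<^bold>= \<^bold>!Size
     THEN (D\<^bold>[Adj\<^bold>[\<^bold>!Arc\<^bold>]\<^bold>] ::= D\<^bold>[\<^bold>!Vert\<^bold>] \<^bold>+ Const 1 ;;
           Queue\<^bold>[\<^bold>!End\<^bold>] ::= Adj\<^bold>[\<^bold>!Arc\<^bold>] ;;
           incr End)
     ELSE Skip"

abbreviation scan :: "array \<Rightarrow> com" where
  "scan D \<equiv> for_loop Arc (Off\<^bold>[\<^bold>!Vert\<^bold>]) (Off\<^bold>[\<^bold>!Vert \<^bold>+ Const 1\<^bold>]) (scan_arc D)"

text \<open>That the cells up to \<open>h\<close> survive is needed twice: the scanned vertex stays
  the same during the loop, and the potential of the surrounding loop refers to the cells already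
  dequeued.\<close>

lemma runs_scan:
  assumes s: "holds_input s" "s Vert 0 = s Queue h" "s Queue h < n"
    and inner: "bfs_inner r h (off (s Queue h)) (s Queue) (s End 0) (s D)" and r: "r < n"
    and D: "D \<notin> {Size, Off, Adj, Vert, Arc, Queue, Head, End}"
  shows "runs (scan D) s (14 + 44 * (off (Suc (s Queue h)) - off (s Queue h)))
    (\<lambda>s'. bfs_inner r h (off (Suc (s' Queue h))) (s' Queue) (s' End 0) (s' D) \<and>
      (\<forall>i\<le>h. s' Queue i = s Queue i))"
proof -
  let ?u = "s Queue h"
  let ?I = "\<lambda>j (s' :: memory). bfs_inner r h j (s' Queue) (s' End 0) (s' D) \<and> (\<forall>i\<le>h. s' Queue i = s Queue i)"
  note sD = holds_inputD[OF s(1)]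
  have Dne: "Size \<noteq> D" "Off \<noteq> D" "Adj \<noteq> D" "Vert \<noteq> D" "Arc \<noteq> D" "Queue \<noteq> D" "Head \<noteq> D" "End \<noteq> D"
    "D \<noteq> Size" "D \<noteq> Off" "D \<noteq> Adj" "D \<noteq> Vert" "D \<noteq> Arc" "D \<noteq> Queue" "D \<noteq> Head" "D \<noteq> End"
    using D by auto
  have "runs (scan D) s (14 + 44 * (off (Suc ?u) - off ?u))
    (\<lambda>s'. ?I (off (Suc ?u)) s' \<and> s' Arc 0 = off (Suc ?u) \<and> agree_off (insert Arc (mods (scan_arc D))) s s')"
  proof (rule runs_for_loop[where I = ?I and l = "off ?u" and B = "\<lambda>_. 29"])
    fix j s1
    assume j: "off ?u \<le> j" "j < off (Suc ?u)" and fr: "agree_off (insert Arc (mods (scan_arc D))) s s1"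
      and s1: "s1 Arc 0 = j" and I: "?I j s1"
    have V: "s1 Vert 0 = s1 Queue h" using agree_offD[OF fr, of Vert] s I Dne by simp
    have "holds_input s1" using holds_input_agree_off[OF s(1) fr] Dne by simp
    note s1D = holds_inputD[OF this]
    have "adj j \<in> {w. {?u, w} \<in> edges G}" using adj_image[OF s(3)] j by auto
    then have ed: "{s1 Queue h, adj j} \<in> edges G" using I by simp
    then have w: "adj j < n" using edge_verts[OF ed] verts_eq by simp
    have h: "h < s1 End 0" using I by (simp add: bfs_inner_def)
    show "runs (scan_arc D) s1 29
        (\<lambda>s2. s2 Arc 0 = j \<and> ?I (Suc j) (s2(Arc := (s2 Arc)(0 := Suc j))))"
    proof (cases "s1 D (adj j) = n")
      case True
      then have "bfs_inner r h (Suc j) ((s1 Queue)(s1 End 0 := adj j)) (Suc (s1 End 0))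
          ((s1 D)(adj j := Suc (s1 D (s1 Queue h))))"
        using bfs_inner_step_new I r ed by blast
      then show ?thesis using True I s1 s1D V h Dne
        by (intro runs_loop_free) (simp_all add: fun_upd_def[of "s1 Queue"] fun_upd_def[of "s1 D"])
    next
      case False
      then have "bfs_inner r h (Suc j) (s1 Queue) (s1 End 0) (s1 D)"
        using bfs_inner_step_old I w by blast
      then show ?thesis using False I s1 s1D V h Dne by (intro runs_loop_free) simp_all
    qed
  next
    fix s' assume fr: "agree_off (insert Arc (mods (scan_arc D))) s s'"
    then show "aval (Off\<^bold>[\<^bold>!Vert \<^bold>+ Const 1\<^bold>]) s' = off (Suc ?u)"
      using agree_offD[OF fr, of Off] agree_offD[OF fr, of Vert] sD s Dne by simp
  qed (use s sD inner Dne off_Suc[OF s(3)] in simp_all)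
  then show ?thesis by (rule runs_mono) auto
qed

abbreviation bfs_loop :: "array \<Rightarrow> com" where
  "bfs_loop D \<equiv> WHILE \<^bold>!Head \<^bold>< \<^bold>!End DO (Vert :== Queue\<^bold>[\<^bold>!Head\<^bold>] ;; incr Head ;; scan D)"

text \<open>Every vertex pays for its own scan. The potential sums these costs over the vertices not
  yet dequeued, and no vertex pays twice because the queue is injective.\<close>

lemma runs_bfs_loop:
  assumes s: "holds_input s" "s Head 0 = 0" and o: "bfs_outer r (s Queue) 0 (s End 0) (s D)" and r: "r < n"
    and D: "D \<notin> {Size, Off, Adj, Vert, Arc, Queue, Head, End}"
  shows "runs (bfs_loop D) s (50 * (n + num_arc) + 6) (\<lambda>s'. \<forall>v<n. s' D v = gdist G r v)"
proof -
  have Dne: "Size \<noteq> D" "Off \<noteq> D" "Adj \<noteq> D" "Vert \<noteq> D" "Arc \<noteq> D" "Queue \<noteq> D" "Head \<noteq> D" "End \<noteq> D"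
    "D \<noteq> Size" "D \<noteq> Off" "D \<noteq> Adj" "D \<noteq> Vert" "D \<noteq> Arc" "D \<noteq> Queue" "D \<noteq> Head" "D \<noteq> End"
    using D by auto
  \<comment> \<open>A round costs at most 31 plus 44 per outgoing arc; 50 is a convenient common
    bound.\<close>
  define cost where "cost v = 50 + 50 * (off (Suc v) - off v)" for v
  define \<Phi> where "\<Phi> s' = sum cost ({..<n} - s' Queue ` {..<s' Head 0})" for s' :: memory
  define J where "J s' \<longleftrightarrow> holds_input s' \<and> bfs_outer r (s' Queue) (s' Head 0) (s' End 0) (s' D)" for s'
  let ?p = "\<^bold>!Head \<^bold>< \<^bold>!End"
  have "J s" using s o by (simp add: J_def)
  then have "runs (bfs_loop D) s (\<Phi> s + bcost ?p + 1) (\<lambda>s'. J s' \<and> \<not> bval ?p s')"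
  proof (rule runs_Loop[where I = J and \<Phi> = \<Phi>])
    fix s1 assume J: "J s1" and b: "bval ?p s1"
    define h where "h = s1 Head 0"
    define u where "u = s1 Queue h"
    have i1: "holds_input s1" and o1: "bfs_outer r (s1 Queue) h (s1 End 0) (s1 D)" and h: "h < s1 End 0"
      using J b by (simp_all add: J_def h_def)
    have inner: "bfs_inner r h (off u) (s1 Queue) (s1 End 0) (s1 D)"
      unfolding u_def by (rule bfs_inner_if_outer[OF o1 h r])
    then have u: "u < n" using h by (auto simp: bfs_inner_def bfs_state_def u_def)
    define s2 where "s2 = effect (incr Head) (effect (Vert :== Queue\<^bold>[\<^bold>!Head\<^bold>]) s1)"
    have s2: "s2 Queue = s1 Queue" "s2 End = s1 End" "s2 D = s1 D" "s2 Vert 0 = s1 Queue h"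
      "s2 Head 0 = Suc h" "holds_input s2"
      using i1 Dne by (simp_all add: s2_def h_def holds_input_def)
    have "runs (scan D) s2 (14 + 44 * (off (Suc (s2 Queue h)) - off (s2 Queue h)))
      (\<lambda>s'. bfs_inner r h (off (Suc (s' Queue h))) (s' Queue) (s' End 0) (s' D) \<and>
        (\<forall>i\<le>h. s' Queue i = s2 Queue i))"
      by (rule runs_scan) (use s2 inner r D u in \<open>simp_all add: u_def\<close>)
    note scan0 = this
    have "runs (scan D) s2 (14 + 44 * (off (Suc u) - off u))
      (\<lambda>s'. J s' \<and> s' Head 0 = Suc h \<and> (\<forall>i\<le>h. s' Queue i = s1 Queue i))"
    proof (rule runs_mono[OF runs_frame[OF scan0]])
      fix s3
      assume *: "(bfs_inner r h (off (Suc (s3 Queue h))) (s3 Queue) (s3 End 0) (s3 D) \<and>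
        (\<forall>i\<le>h. s3 Queue i = s2 Queue i)) \<and> agree_off (mods (scan D)) s2 s3"
      then have fr: "agree_off (mods (scan D)) s2 s3" by simp
      have "bfs_outer r (s3 Queue) (Suc h) (s3 End 0) (s3 D)"
        using * by (intro bfs_outer_if_inner) blast
      moreover
      have "s3 Head 0 = Suc h" using agree_offD[OF fr, of Head] s2 Dne by simp
      moreover have "holds_input s3" using holds_input_agree_off[OF s2(6) fr] Dne by simp
      ultimately show "J s3 \<and> s3 Head 0 = Suc h \<and> (\<forall>i\<le>h. s3 Queue i = s1 Queue i)"
        using * s2(1) by (simp add: J_def)
    qed (simp add: u_def s2)
    note scan = this[unfolded s2_def]
    have "runs (Vert :== Queue\<^bold>[\<^bold>!Head\<^bold>] ;; incr Head ;; scan D) s1 (25 + 44 * (off (Suc u) - off u))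
      (\<lambda>s'. J s' \<and> s' Head 0 = Suc h \<and> (\<forall>i\<le>h. s' Queue i = s1 Queue i))"
      by (rule runs_mono[OF runs_loop_free_Seq[OF _ runs_loop_free_Seq[OF _ scan]]]) simp_all
    moreover have "bcost ?p + (25 + 44 * (off (Suc u) - off u)) + 1 + \<Phi> s' \<le> \<Phi> s1"
      if s': "s' Head 0 = Suc h" "\<forall>i\<le>h. s' Queue i = s1 Queue i" for s'
    proof -
      have inj: "inj_on (s1 Queue) {..<s1 End 0}" using o1 by (simp add: bfs_outer_def bfs_state_def)
      have "s' Queue ` {..<Suc h} = s1 Queue ` {..<Suc h}" using s'(2) by (intro image_cong) auto
      then have img: "s' Queue ` {..<Suc h} = insert u (s1 Queue ` {..<h})"
        by (simp add: lessThan_Suc u_def)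
      have "u \<notin> s1 Queue ` {..<h}"
        using inj_onD[OF inj, of h] h unfolding u_def by fastforce
      then have "{..<n} - s1 Queue ` {..<h} = insert u ({..<n} - s' Queue ` {..<Suc h})"
        "u \<notin> {..<n} - s' Queue ` {..<Suc h}"
        using img u by auto
      then have "\<Phi> s1 = cost u + \<Phi> s'" by (simp add: \<Phi>_def s'(1) flip: h_def)
      then show ?thesis by (simp add: cost_def)
    qed
    ultimately show "\<exists>T. runs (Vert :== Queue\<^bold>[\<^bold>!Head\<^bold>] ;; incr Head ;; scan D) s1 T
        (\<lambda>s'. J s' \<and> bcost ?p + T + 1 + \<Phi> s' \<le> \<Phi> s1)"
      by (intro exI[of _ "25 + 44 * (off (Suc u) - off u)"]) (auto elim!: runs_mono)
  qed
  then show ?thesis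
  proof (rule runs_mono)
    have "(\<Sum>v<n. off (Suc v) - off v) = num_arc" by (rule sum_degrees) simp
    then show "\<Phi> s + bcost ?p + 1 \<le> 50 * (n + num_arc) + 6"
      using s by (simp add: \<Phi>_def cost_def sum.distrib flip: sum_distrib_left)
    fix s' assume s': "J s' \<and> \<not> bval ?p s'"
    then have "bfs_outer r (s' Queue) (s' End 0) (s' End 0) (s' D)"
      by (auto simp: J_def bfs_outer_def)
    then show "\<forall>v<n. s' D v = gdist G r v" using bfs_outer_end r by blast
  qed
qed

lemma runs_bfs:
  assumes s: "holds_input s" and r: "s root 0 < n"
    and D: "D \<notin> {Size, Off, Adj, Vert, Arc, Queue, Head, End}"
    and root: "root \<notin> {D, Vert}"
  shows "runs (bfs root D) s (70 * (n + num_arc + 1)) (\<lambda>s'. \<forall>v<n. s' D v = gdist G (s root 0) v)"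
proof -
  let ?r = "s root 0"
  have Dne: "Size \<noteq> D" "Off \<noteq> D" "Adj \<noteq> D" "Vert \<noteq> D" "Arc \<noteq> D" "Queue \<noteq> D" "Head \<noteq> D" "End \<noteq> D"
    "D \<noteq> Size" "D \<noteq> Off" "D \<noteq> Adj" "D \<noteq> Vert" "D \<noteq> Arc" "D \<noteq> Queue" "D \<noteq> Head" "D \<noteq> End"
    "root \<noteq> D" "root \<noteq> Vert"
    using D root by auto
  note sD = holds_inputD[OF s]
  let ?body = "D\<^bold>[\<^bold>!Vert\<^bold>] ::= \<^bold>!Size"
  have init: "runs (for_loop Vert (Const 0) (\<^bold>!Size) ?body) s (9 + 17 * n)
    (\<lambda>s'. (\<forall>v<n. s' D v = n) \<and> s' Vert 0 = n \<and> agree_off (insert Vert (mods ?body)) s s')"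
  proof (rule runs_for_loop[where I = "\<lambda>i s'. \<forall>v<i. s' D v = n" and l = 0 and B = "\<lambda>_. 5"])
    fix i s1 assume "agree_off (insert Vert (mods ?body)) s s1" "s1 Vert 0 = i" "\<forall>v<i. s1 D v = n"
    then show "runs ?body s1 5 (\<lambda>s2. s2 Vert 0 = i \<and>
        (\<forall>v<Suc i. (s2(Vert := (s2 Vert)(0 := Suc i))) D v = n))"
      using sD Dne by (intro runs_loop_free) (auto simp: agree_offD less_Suc_eq)
  qed (use sD Dne in \<open>simp_all add: agree_offD\<close>)
  show ?thesis unfolding bfs_def
  proof (rule runs_Seq[OF init])
    fix s1 assume s1: "(\<forall>v<n. s1 D v = n) \<and> s1 Vert 0 = n \<and> agree_off (insert Vert (mods ?body)) s s1"
    have fr: "agree_off (insert Vert (mods ?body)) s s1" using s1 by simp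
    have i1: "holds_input s1" using holds_input_agree_off[OF s fr] Dne by simp
    have r1: "s1 root 0 = ?r" using agree_offD[OF fr, of root] Dne by simp
    define s2 where "s2 = effect (End :== Const 1) (effect (Head :== Const 0)
      (effect (Queue\<^bold>[Const 0\<^bold>] ::= \<^bold>!root) (effect (D\<^bold>[\<^bold>!root\<^bold>] ::= Const 0) s1)))"
    have "holds_input s2" "s2 Head 0 = 0" "s2 End 0 = 1" "s2 Queue 0 = ?r"
      "\<forall>v<n. s2 D v = (if v = ?r then 0 else n)"
      using i1 r1 s1 Dne by (auto simp: s2_def holds_input_def)
    then have "runs (bfs_loop D) s2 (50 * (n + num_arc) + 6) (\<lambda>s'. \<forall>v<n. s' D v = gdist G ?r v)"
      using bfs_outer_init[OF r] by (intro runs_bfs_loop r D) simp_all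
    note loop = this[unfolded s2_def]
    show "runs (D\<^bold>[\<^bold>!root\<^bold>] ::= Const 0 ;; Queue\<^bold>[Const 0\<^bold>] ::= \<^bold>!root ;; Head :== Const 0 ;; End :== Const 1 ;;
        bfs_loop D) s1 (50 * (n + num_arc) + 20) (\<lambda>s'. \<forall>v<n. s' D v = gdist G ?r v)"
      by (rule runs_mono[OF runs_loop_free_Seq[OF _ runs_loop_free_Seq[OF _ runs_loop_free_Seq[OF _
        runs_loop_free_Seq[OF _ loop]]]]]) simp_all
  qed simp
qed

end

section \<open>The labelling program\<close>

lemma mods_bfs [simp]: "mods (bfs r D) = {Vert, D, Queue, Head, End, Arc}"
  by (auto simp: bfs_def)

lemma mods_end_distances [simp]:
  "mods end_distances = {EndA, EndB, DistA, DistB, Vert, Queue, Head, End, Arc}"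
  by (auto simp: end_distances_def)

lemma mods_choose_edge [simp]: "mods choose_edge = {NumCand, Arc, Cand, Edge}"
  by (auto simp: choose_edge_def)

lemma mods_split_vertices [simp]: "mods (split_vertices c d) = insert Vert (mods c \<union> mods d)"
  by (auto simp: split_vertices_def)

lemma mods_compute_theta_classes [simp]:
  "mods compute_theta_classes =
     {Cls, NumCls, Edge, EndA, EndB, DistA, DistB, Vert, Queue, Head, End, Arc}"
  by (auto simp: compute_theta_classes_def)

lemma mods_compute_tails [simp]: "mods compute_tails = {Vert, Arc, Tail}"
  by (auto simp: compute_tails_def)

lemma mods_compute_labels [simp]:
  "mods compute_labels = {Base, Class, NumCand, Arc, Cand, Edge, EndA, EndB, DistA, DistB,
     Vert, Queue, Head, End, CountA, CountB, BitA, BitB, Lab}"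
  by (auto simp: compute_labels_def)

context daisy_input
begin

text \<open>The summand 1 makes this positive, so that constant costs can be absorbed into multiples
  of it.\<close>

definition input_size :: nat where "input_size = n + num_arc + 1"

lemma input_size_ge: "n \<le> input_size" "num_arc \<le> input_size" "1 \<le> input_size"
  by (simp_all add: input_size_def)

definition holds_tails :: "memory \<Rightarrow> bool" where
  "holds_tails s \<longleftrightarrow> (\<forall>j<num_arc. s Tail j = tail_of j)"

lemma holds_tails_agree_off: "\<lbrakk>holds_tails s; agree_off Y s s'; Tail \<notin> Y\<rbrakk> \<Longrightarrow> holds_tails s'"
  by (simp add: holds_tails_def agree_off_def)

definition holds_distances :: "nat \<Rightarrow> memory \<Rightarrow> bool" where
  "holds_distances e s \<longleftrightarrow>
     (\<forall>v<n. s DistA v = gdist G (tail_of e) v \<and> s DistB v = gdist G (adj e) v)"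

lemma runs_end_distances:
  assumes s: "holds_input s" "holds_tails s" and e: "s Edge 0 = e" "e < num_arc"
  shows "runs end_distances s (150 * input_size) (holds_distances e)"
proof -
  define s1 where "s1 = effect (EndB :== Adj\<^bold>[\<^bold>!Edge\<^bold>]) (effect (EndA :== Tail\<^bold>[\<^bold>!Edge\<^bold>]) s)"
  have s1: "holds_input s1" "s1 EndA 0 = tail_of e" "s1 EndB 0 = adj e"
    using s e by (simp_all add: s1_def holds_input_def holds_tails_def)
  have "runs (bfs EndA DistA) s1 (70 * (n + num_arc + 1)) (\<lambda>s'. \<forall>v<n. s' DistA v = gdist G (s1 EndA 0) v)"
    by (rule runs_bfs) (use s1 tail_of(1)[OF e(2)] in simp_all)
  then have rest: "runs (bfs EndA DistA ;; bfs EndB DistB) s1 (140 * input_size) (holds_distances e)"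
  proof (rule runs_Seq_frame)
    fix s2 assume s2: "\<forall>v<n. s2 DistA v = gdist G (s1 EndA 0) v"
      and fr: "agree_off (mods (bfs EndA DistA)) s1 s2"
    have "holds_input s2" using holds_input_agree_off[OF s1(1) fr] by simp
    moreover have b: "s2 EndB 0 = adj e" using agree_offD[OF fr, of EndB] s1 by simp
    ultimately have B: "runs (bfs EndB DistB) s2 (70 * (n + num_arc + 1))
        (\<lambda>s'. \<forall>v<n. s' DistB v = gdist G (s2 EndB 0) v)"
      using adj_less[OF e(2)] by (intro runs_bfs) simp_all
    show "runs (bfs EndB DistB) s2 (70 * (n + num_arc + 1)) (holds_distances e)"
    proof (rule runs_mono[OF runs_frame[OF B] le_refl])
      fix s3 assume s3: "(\<forall>v<n. s3 DistB v = gdist G (s2 EndB 0) v) \<and> agree_off (mods (bfs EndB DistB)) s2 s3"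
      then have "s3 DistA = s2 DistA" using agree_offD[of "mods (bfs EndB DistB)" s2 s3 DistA] by simp
      then show "holds_distances e s3" using s3 s2 s1 b by (simp add: holds_distances_def)
    qed
  qed (simp add: input_size_def)
  note rest = rest[unfolded s1_def]
  show ?thesis unfolding end_distances_def
    by (rule runs_mono[OF runs_loop_free_Seq[OF _ runs_loop_free_Seq[OF _ rest]]])
      (use input_size_ge in simp_all)
qed

subsection \<open>Computing the classes\<close>

text \<open>\<open>L\<close> is a ghost list: it contains the directions met among the first
  \<open>e\<close> arcs in order of discovery, so that the class number in \<open>Cls\<close> is an
  index into \<open>L\<close>.\<close>

definition classes_inv :: "nat list \<Rightarrow> nat \<Rightarrow> memory \<Rightarrow> bool" where
  "classes_inv L e s \<longleftrightarrow> distinct L \<and> set L = dir_of ` {..<e} \<and> s NumCls 0 = length L \<and>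
     (\<forall>j<num_arc. if dir_of j \<in> set L then s Cls j < length L \<and> L ! s Cls j = dir_of j
                  else s Cls j = num_arc)"

abbreviation mark_arc :: com where
  "mark_arc \<equiv>
     IF DistA\<^bold>[Tail\<^bold>[\<^bold>!Arc\<^bold>]\<^bold>] \<^bold>+ DistB\<^bold>[Adj\<^bold>[\<^bold>!Arc\<^bold>]\<^bold>] \<^bold>= DistA\<^bold>[Adj\<^bold>[\<^bold>!Arc\<^bold>]\<^bold>] \<^bold>+ DistB\<^bold>[Tail\<^bold>[\<^bold>!Arc\<^bold>]\<^bold>]
     THEN Skip ELSE Cls\<^bold>[\<^bold>!Arc\<^bold>] ::= \<^bold>!NumCls"

lemma runs_mark_arcs:
  assumes s: "holds_input s" "holds_tails s" "holds_distances e s" and e: "e < num_arc"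
  shows "runs (for_loop Arc (Const 0) num_arcs mark_arc) s (50 * input_size)
    (\<lambda>s'. \<forall>j<num_arc. s' Cls j = (if dir_of j = dir_of e then s NumCls 0 else s Cls j))"
proof -
  let ?I = "\<lambda>i (s' :: memory). \<forall>j<num_arc.
    s' Cls j = (if j < i \<and> dir_of j = dir_of e then s NumCls 0 else s Cls j)"
  note sD = holds_inputD[OF s(1)]
  have "runs (for_loop Arc (Const 0) num_arcs mark_arc) s (50 * input_size)
    (\<lambda>s'. ?I num_arc s' \<and> s' Arc 0 = num_arc \<and> agree_off (insert Arc (mods mark_arc)) s s')"
  proof (rule runs_for_loop[where I = ?I and l = 0 and B = "\<lambda>_. 25"])
    fix i s1
    assume i: "i < num_arc" and fr: "agree_off (insert Arc (mods mark_arc)) s s1"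
      and s1: "s1 Arc 0 = i" and I: "?I i s1"
    have keep: "s1 y = s y" if "y \<notin> {Arc, Cls}" for y using agree_offD[OF fr, of y] that by simp
    have lt: "tail_of i < n" "adj i < n" using tail_of(1) adj_less i by auto
    have test: "s DistA (s Tail i) + s DistB (adj i) = s DistA (adj i) + s DistB (s Tail i)
        \<longleftrightarrow> dir_of i \<noteq> dir_of e"
      using dir_of_eq_iff[OF e i] s lt i by (simp add: holds_distances_def holds_tails_def)
    show "runs mark_arc s1 25 (\<lambda>s2. s2 Arc 0 = i \<and> ?I (Suc i) (s2(Arc := (s2 Arc)(0 := Suc i))))"
      by (rule runs_loop_free) (use test I in \<open>auto simp: s1 keep sD less_Suc_eq\<close>)
  next
    fix s' assume fr: "agree_off (insert Arc (mods mark_arc)) s s'"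
    show "aval num_arcs s' = num_arc"
      using agree_offD[OF fr, of Off] agree_offD[OF fr, of Size] sD by simp
  qed (use input_size_ge in simp_all)
  then show ?thesis by (rule runs_mono) auto
qed

abbreviation new_class :: com where
  "new_class \<equiv> end_distances ;; for_loop Arc (Const 0) num_arcs mark_arc ;; incr NumCls"

text \<open>The marking pass touches exactly the arcs with the direction of \<open>e\<close>. This
  direction is not yet in \<open>L\<close>, so no arc of an older class is overwritten.\<close>

lemma runs_new_class:
  assumes s: "holds_input s" "holds_tails s" "s Edge 0 = e" and e: "e < num_arc"
    and inv: "classes_inv L e s" and new: "dir_of e \<notin> set L"
  shows "runs new_class s (206 * input_size) (classes_inv (L @ [dir_of e]) (Suc e))"
proof (rule runs_Seq_frame[OF runs_end_distances[OF s e]])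
  fix s1 assume d1: "holds_distances e s1" and fr1: "agree_off (mods end_distances) s s1"
  have i1: "holds_input s1" using holds_input_agree_off[OF s(1) fr1] by simp
  have t1: "holds_tails s1" using holds_tails_agree_off[OF s(2) fr1] by simp
  have s1: "s1 Cls = s Cls" "s1 NumCls = s NumCls"
    using agree_offD[OF fr1, of Cls] agree_offD[OF fr1, of NumCls] by simp_all
  show "runs (for_loop Arc (Const 0) num_arcs mark_arc ;; incr NumCls) s1 (56 * input_size)
      (classes_inv (L @ [dir_of e]) (Suc e))"
  proof (rule runs_Seq_frame[OF runs_mark_arcs[OF i1 t1 d1 e]])
    fix s2 assume s2: "\<forall>j<num_arc. s2 Cls j = (if dir_of j = dir_of e then s1 NumCls 0 else s1 Cls j)"
      and fr2: "agree_off (mods (for_loop Arc (Const 0) num_arcs mark_arc)) s1 s2"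
    have "s2 NumCls 0 = length L"
      using agree_offD[OF fr2, of NumCls] s1 inv by (simp add: classes_inv_def)
    moreover have "set (L @ [dir_of e]) = dir_of ` {..<Suc e}"
      using inv by (auto simp: classes_inv_def lessThan_Suc)
    moreover have "if dir_of j \<in> set (L @ [dir_of e])
        then s2 Cls j < Suc (length L) \<and> (L @ [dir_of e]) ! s2 Cls j = dir_of j else s2 Cls j = num_arc"
      if j: "j < num_arc" for j
    proof (cases "dir_of j = dir_of e")
      case True
      then show ?thesis using s2 j s1 inv by (simp add: classes_inv_def)
    next
      case False
      then show ?thesis using s2 j s1 inv by (auto simp: classes_inv_def nth_append split: if_splits)
    qed
    ultimately show "runs (incr NumCls) s2 6 (classes_inv (L @ [dir_of e]) (Suc e))"
      using inv new by (intro runs_loop_free) (simp_all add: classes_inv_def)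
  qed (use input_size_ge in simp)
qed simp

text \<open>A class is started only by the first arc of its direction, so at most \<open>n\<close> times.\<close>

lemma sum_first_arcs:
  "(\<Sum>e=0..<num_arc. if dir_of e \<in> dir_of ` {..<e} then 0 else c) \<le> n * c"
proof -
  let ?F = "{e \<in> {0..<num_arc}. dir_of e \<notin> dir_of ` {..<e}}"
  have sum: "(\<Sum>e=0..<num_arc. if dir_of e \<in> dir_of ` {..<e} then 0 else c) =
      (\<Sum>e=0..<num_arc. if dir_of e \<notin> dir_of ` {..<e} then c else 0)"
    by (rule sum.cong) auto
  have "card ?F = card (dir_of ` ?F)"
  proof (rule card_image[symmetric], rule inj_onI)
    fix a b assume "a \<in> ?F" "b \<in> ?F" "dir_of a = dir_of b"
    moreover have "dir_of x \<noteq> dir_of y" if "y \<in> ?F" "x < y" for x y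
      using that by (metis (mono_tags, lifting) imageI lessThan_iff mem_Collect_eq)
    ultimately show "a = b" by (metis linorder_neqE_nat)
  qed
  also have "\<dots> \<le> card (dir_of ` {..<num_arc})" by (rule card_mono) auto
  also have "\<dots> \<le> n" by (rule card_directions)
  finally have "card ?F * c \<le> n * c" by simp
  then show ?thesis unfolding sum by (subst sum.inter_filter[symmetric]) simp_all
qed

lemma runs_compute_theta_classes:
  assumes s: "holds_input s" "holds_tails s"
  shows "runs compute_theta_classes s (60 * input_size + 210 * (n * input_size))
    (\<lambda>s'. \<exists>L. classes_inv L num_arc s')"
proof -
  note sD = holds_inputD[OF s(1)]
  let ?init = "Cls\<^bold>[\<^bold>!Arc\<^bold>] ::= num_arcs"
  have init: "runs (for_loop Arc (Const 0) num_arcs ?init) s (10 + 19 * num_arc)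
    (\<lambda>s'. (\<forall>j<num_arc. s' Cls j = num_arc) \<and> s' Arc 0 = num_arc \<and> agree_off (insert Arc (mods ?init)) s s')"
  proof (rule runs_for_loop[where I = "\<lambda>i s'. \<forall>j<i. s' Cls j = num_arc" and l = 0 and B = "\<lambda>_. 6"])
    fix i s1 assume fr: "agree_off (insert Arc (mods ?init)) s s1"
      and "s1 Arc 0 = i" "\<forall>j<i. s1 Cls j = num_arc"
    then show "runs ?init s1 6 (\<lambda>s2. s2 Arc 0 = i \<and>
        (\<forall>j<Suc i. (s2(Arc := (s2 Arc)(0 := Suc i))) Cls j = num_arc))"
      using sD agree_offD[OF fr, of Off] agree_offD[OF fr, of Size]
      by (intro runs_loop_free) (auto simp: less_Suc_eq)
  next
    fix s' assume fr: "agree_off (insert Arc (mods ?init)) s s'"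
    show "aval num_arcs s' = num_arc"
      using agree_offD[OF fr, of Off] agree_offD[OF fr, of Size] sD by simp
  qed simp_all
  let ?body = "IF Cls\<^bold>[\<^bold>!Edge\<^bold>] \<^bold>= num_arcs THEN new_class ELSE Skip"
  let ?loop = "for_loop Edge (Const 0) num_arcs ?body"
  show ?thesis unfolding compute_theta_classes_def
  proof (rule runs_Seq[OF init])
    fix s1 assume s1: "(\<forall>j<num_arc. s1 Cls j = num_arc) \<and> s1 Arc 0 = num_arc \<and>
      agree_off (insert Arc (mods ?init)) s s1"
    then have fr1: "agree_off (insert Arc (mods ?init)) s s1" by simp
    define s2 where "s2 = effect (NumCls :== Const 0) s1"
    have i2: "holds_input s2" using holds_input_agree_off[OF s(1) fr1] by (simp add: s2_def holds_input_def)
    have t2: "holds_tails s2" using holds_tails_agree_off[OF s(2) fr1] by (simp add: s2_def holds_tails_def)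
    have inv2: "classes_inv [] 0 s2" using s1 by (simp add: s2_def classes_inv_def)
    have "runs ?loop s2 (30 * input_size + 210 * (n * input_size))
      (\<lambda>s'. (\<exists>L. classes_inv L num_arc s') \<and> s' Edge 0 = num_arc \<and> agree_off (insert Edge (mods ?body)) s2 s')"
    \<comment> \<open>Testing and skipping an arc costs 9. The 206 consists of 150 for the two
      searches, 50 for marking and 6 for counting, and is charged only to the first arc of each
      direction.\<close>
    proof (rule runs_for_loop[where I = "\<lambda>e s'. \<exists>L. classes_inv L e s'" and l = 0
          and B = "\<lambda>e. 9 + (if dir_of e \<in> dir_of ` {..<e} then 0 else 206 * input_size)"])
      fix e s3
      assume e: "e < num_arc" and fr: "agree_off (insert Edge (mods ?body)) s2 s3"
        and s3: "s3 Edge 0 = e" and "\<exists>L. classes_inv L e s3"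
      then obtain L where L: "classes_inv L e s3" by blast
      have i3: "holds_input s3" using holds_input_agree_off[OF i2 fr] by simp
      have t3: "holds_tails s3" using holds_tails_agree_off[OF t2 fr] by simp
      have setL: "set L = dir_of ` {..<e}" and dL: "distinct L" using L by (simp_all add: classes_inv_def)
      \<comment> \<open>At most \<open>e\<close> classes have been started, so every class number is
        less than \<open>num_arc\<close> and cannot be mistaken for the mark of an unclassified
        arc.\<close>
      have "length L = card (dir_of ` {..<e})" using distinct_card[OF dL] setL by simp
      also have "\<dots> \<le> e" using card_image_le[of "{..<e}" dir_of] by simp
      finally have len: "length L < num_arc" using e by simp
      have unmarked: "s3 Cls e = num_arc \<longleftrightarrow> dir_of e \<notin> set L"
      proof -
        have "if dir_of e \<in> set L then s3 Cls e < length L \<and> L ! s3 Cls e = dir_of e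
          else s3 Cls e = num_arc"
          using L e by (simp add: classes_inv_def)
        then show ?thesis using len by (auto split: if_splits)
      qed
      note s3D = holds_inputD[OF i3]
      have inv_Edge: "classes_inv L' e' (s'(Edge := g)) \<longleftrightarrow> classes_inv L' e' s'" for L' e' s' g
        by (simp add: classes_inv_def)
      show "runs ?body s3 (9 + (if dir_of e \<in> dir_of ` {..<e} then 0 else 206 * input_size))
          (\<lambda>s4. s4 Edge 0 = e \<and> (\<exists>L. classes_inv L (Suc e) (s4(Edge := (s4 Edge)(0 := Suc e)))))"
      proof (rule runs_Cond[where T = "if dir_of e \<in> dir_of ` {..<e} then 1 else 206 * input_size"])
        assume "bval (Cls\<^bold>[\<^bold>!Edge\<^bold>] \<^bold>= num_arcs) s3"
        then have new: "dir_of e \<notin> set L" using unmarked s3 s3D by simp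
        show "runs new_class s3 (if dir_of e \<in> dir_of ` {..<e} then 1 else 206 * input_size)
          (\<lambda>s4. s4 Edge 0 = e \<and> (\<exists>L. classes_inv L (Suc e) (s4(Edge := (s4 Edge)(0 := Suc e)))))"
        proof (rule runs_mono[OF runs_frame[OF runs_new_class[OF i3 t3 s3 e L new]]])
          fix s4 assume s4: "classes_inv (L @ [dir_of e]) (Suc e) s4 \<and> agree_off (mods new_class) s3 s4"
          then have "s4 Edge = s3 Edge" using agree_offD[of "mods new_class" s3 s4 Edge] by simp
          then show "s4 Edge 0 = e \<and> (\<exists>L. classes_inv L (Suc e) (s4(Edge := (s4 Edge)(0 := Suc e))))"
            using s4 s3 unfolding inv_Edge by auto
        qed (use new setL in simp)
      next
        assume "\<not> bval (Cls\<^bold>[\<^bold>!Edge\<^bold>] \<^bold>= num_arcs) s3"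
        then have old: "dir_of e \<in> set L" using unmarked s3 s3D by simp
        then have "classes_inv L (Suc e) s3"
          using L unfolding classes_inv_def by (auto simp: lessThan_Suc)
        then show "runs Skip s3 (if dir_of e \<in> dir_of ` {..<e} then 1 else 206 * input_size)
          (\<lambda>s4. s4 Edge 0 = e \<and> (\<exists>L. classes_inv L (Suc e) (s4(Edge := (s4 Edge)(0 := Suc e)))))"
          using old setL s3 by (intro runs_loop_free) (auto simp: inv_Edge)
      qed simp
    next
      fix s' assume fr: "agree_off (insert Edge (mods ?body)) s2 s'"
      show "aval num_arcs s' = num_arc"
        using agree_offD[OF fr, of Off] agree_offD[OF fr, of Size] holds_inputD[OF i2] by simp
    next
      show "\<exists>L. classes_inv L 0 (s2(Edge := (s2 Edge)(0 := 0)))"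
        using inv2 by (intro exI[of _ "[]"]) (simp add: classes_inv_def)
      have "(\<Sum>i=0..<num_arc. 9 + (if dir_of i \<in> dir_of ` {..<i} then 0 else 206 * input_size) +
          acost num_arcs + 10) =
        22 * num_arc + (\<Sum>i=0..<num_arc. if dir_of i \<in> dir_of ` {..<i} then 0 else 206 * input_size)"
        by (simp add: sum.distrib)
      also have "\<dots> \<le> 22 * num_arc + 206 * (n * input_size)"
        using sum_first_arcs[of "206 * input_size"] by (simp add: algebra_simps)
      finally have sum: "(\<Sum>i=0..<num_arc. 9 + (if dir_of i \<in> dir_of ` {..<i} then 0 else 206 * input_size) +
          acost num_arcs + 10) \<le> 22 * num_arc + 206 * (n * input_size)" .
      have "num_arc + 1 \<le> input_size" by (simp add: input_size_def)
      then show "acost (Const 0) + acost num_arcs + 6 +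
        (\<Sum>i=0..<num_arc. 9 + (if dir_of i \<in> dir_of ` {..<i} then 0 else 206 * input_size) +
          acost num_arcs + 10) \<le> 30 * input_size + 210 * (n * input_size)"
        using sum unfolding acost.simps by linarith
    qed simp_all
    then have "runs ?loop s2 (30 * input_size + 210 * (n * input_size)) (\<lambda>s'. \<exists>L. classes_inv L num_arc s')"
      by (rule runs_mono) auto
    note loop = this[unfolded s2_def]
    show "runs (NumCls :== Const 0 ;; ?loop) s1 (34 * input_size + 210 * (n * input_size))
      (\<lambda>s'. \<exists>L. classes_inv L num_arc s')"
      by (rule runs_mono[OF runs_loop_free_Seq[OF _ loop]]) (use input_size_ge in simp_all)
  qed (simp add: input_size_def)
qed

subsection \<open>Computing the labels\<close>

text \<open>The invariant keeps two facts: every candidate belongs to the class, and there is a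
  candidate as soon as an arc of the class has been passed. Then any content of
  \<open>Choice\<close> selects an arc of the class.\<close>

lemma runs_choose_edge:
  assumes s: "holds_input s" and ex: "\<exists>j<num_arc. s Cls j = s Class 0"
  shows "runs choose_edge s (50 * input_size)
    (\<lambda>s'. s' Edge 0 < num_arc \<and> s Cls (s' Edge 0) = s Class 0)"
proof -
  let ?body = "IF Cls\<^bold>[\<^bold>!Arc\<^bold>] \<^bold>= \<^bold>!Class THEN (Cand\<^bold>[\<^bold>!NumCand\<^bold>] ::= \<^bold>!Arc ;; incr NumCand) ELSE Skip"
  let ?Y = "insert Arc (mods ?body)"
  let ?I = "\<lambda>i (s' :: memory). (\<forall>q<s' NumCand 0. s' Cand q < i \<and> s Cls (s' Cand q) = s Class 0) \<and>
    ((\<exists>j<i. s Cls j = s Class 0) \<longrightarrow> 0 < s' NumCand 0)"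
  define s1 where "s1 = effect (NumCand :== Const 0) s"
  have s1: "s1 Size = s Size" "s1 Off = s Off" "s1 Cls = s Cls" "s1 Class = s Class" "s1 NumCand 0 = 0"
    by (simp_all add: s1_def)
  note sD = holds_inputD[OF s]
  have loop: "runs (for_loop Arc (Const 0) num_arcs ?body) s1 (31 * input_size)
      (\<lambda>s'. ?I num_arc s' \<and> s' Arc 0 = num_arc \<and> agree_off ?Y s1 s')"
  proof (rule runs_for_loop[where I = ?I and l = 0 and B = "\<lambda>_. 18"])
    fix i s2
    assume fr: "agree_off ?Y s1 s2" and s2: "s2 Arc 0 = i" and I: "?I i s2"
    have keep: "s2 Cls = s Cls" "s2 Class = s Class"
      using agree_offD[OF fr, of Cls] agree_offD[OF fr, of Class] s1 by simp_all
    show "runs ?body s2 18 (\<lambda>s3. s3 Arc 0 = i \<and> ?I (Suc i) (s3(Arc := (s3 Arc)(0 := Suc i))))"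
      by (rule runs_loop_free) (use I in \<open>auto simp: s2 keep less_Suc_eq\<close>)
  next
    fix s' assume fr: "agree_off ?Y s1 s'"
    show "aval num_arcs s' = num_arc"
      using agree_offD[OF fr, of Off] agree_offD[OF fr, of Size] s1 sD by simp
  qed (simp_all add: s1 input_size_def)
  have "runs (for_loop Arc (Const 0) num_arcs ?body ;; Edge :== Cand\<^bold>[Choice\<^bold>[\<^bold>!Class\<^bold>] \<^bold>% \<^bold>!NumCand\<^bold>]) s1
      (31 * input_size + 9) (\<lambda>s'. s' Edge 0 < num_arc \<and> s Cls (s' Edge 0) = s Class 0)"
  proof (rule runs_Seq[OF loop])
    fix s2 assume "?I num_arc s2 \<and> s2 Arc 0 = num_arc \<and> agree_off ?Y s1 s2"
    then have c: "\<forall>q<s2 NumCand 0. s2 Cand q < num_arc \<and> s Cls (s2 Cand q) = s Class 0"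
      and "0 < s2 NumCand 0" using ex by auto
    \<comment> \<open>Positivity of \<open>NumCand\<close> matters: the remainder modulo 0 would be
      the unreduced content of \<open>Choice\<close>, not a valid index.\<close>
    then have "s2 Choice (s2 Class 0) mod s2 NumCand 0 < s2 NumCand 0" by simp
    then show "runs (Edge :== Cand\<^bold>[Choice\<^bold>[\<^bold>!Class\<^bold>] \<^bold>% \<^bold>!NumCand\<^bold>]) s2 9
        (\<lambda>s'. s' Edge 0 < num_arc \<and> s Cls (s' Edge 0) = s Class 0)"
      using c by (intro runs_loop_free) simp_all
  qed simp
  note rest = this[unfolded s1_def]
  show ?thesis unfolding choose_edge_def
    by (rule runs_mono[OF runs_loop_free_Seq[OF _ rest]]) (simp_all add: input_size_def)
qed

lemma W_holds_distances:
  assumes "holds_distances e s"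
  shows "W G (tail_of e) (adj e) = {v. v < n \<and> s DistA v < s DistB v}"
    and "W G (adj e) (tail_of e) = {v. v < n \<and> s DistB v < s DistA v}"
  using assms by (auto simp: W_def verts_eq holds_distances_def)

lemma card_less_Suc:
  "card {v. v < Suc m \<and> P v} = card {v. v < m \<and> P v} + (if P m then 1 else 0)"
proof -
  have "{v. v < Suc m \<and> P v} = (if P m then insert m {v. v < m \<and> P v} else {v. v < m \<and> P v})"
    by (auto simp: less_Suc_eq)
  then show ?thesis by simp
qed

lemma runs_count_sides:
  assumes s: "holds_input s" "s CountA 0 = 0" "s CountB 0 = 0"
  shows "runs (split_vertices (incr CountA) (incr CountB)) s (34 * input_size)
    (\<lambda>s'. s' CountA 0 = card {v. v < n \<and> s DistA v < s DistB v} \<and>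
      s' CountB 0 = card {v. v < n \<and> s DistB v < s DistA v})"
proof -
  let ?body = "IF DistA\<^bold>[\<^bold>!Vert\<^bold>] \<^bold>< DistB\<^bold>[\<^bold>!Vert\<^bold>] THEN incr CountA
    ELSE IF DistB\<^bold>[\<^bold>!Vert\<^bold>] \<^bold>< DistA\<^bold>[\<^bold>!Vert\<^bold>] THEN incr CountB ELSE Skip"
  let ?Y = "insert Vert (mods ?body)"
  let ?I = "\<lambda>i (s' :: memory). s' CountA 0 = card {v. v < i \<and> s DistA v < s DistB v} \<and>
      s' CountB 0 = card {v. v < i \<and> s DistB v < s DistA v}"
  have "runs (split_vertices (incr CountA) (incr CountB)) s (34 * input_size)
    (\<lambda>s'. ?I n s' \<and> s' Vert 0 = n \<and> agree_off ?Y s s')"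
    unfolding split_vertices_def
  proof (rule runs_for_loop[where I = ?I and l = 0 and B = "\<lambda>_. 22"])
    fix i s1
    assume fr: "agree_off ?Y s s1" and s1: "s1 Vert 0 = i" and I: "?I i s1"
    have keep: "s1 DistA = s DistA" "s1 DistB = s DistB"
      using agree_offD[OF fr, of DistA] agree_offD[OF fr, of DistB] by simp_all
    show "runs ?body s1 22 (\<lambda>s2. s2 Vert 0 = i \<and> ?I (Suc i) (s2(Vert := (s2 Vert)(0 := Suc i))))"
      by (rule runs_loop_free) (use I in \<open>simp_all add: s1 keep card_less_Suc\<close>)
  next
    fix s' assume fr: "agree_off ?Y s s'"
    show "aval \<^bold>!Size s' = n" using agree_offD[OF fr, of Size] holds_inputD[OF s(1)] by simp
  qed (use s in \<open>simp_all add: input_size_def\<close>)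
  then show ?thesis by (rule runs_mono) auto
qed

text \<open>The clause on cells below \<open>Base\<close> preserves the coordinates written for
  earlier classes.\<close>

lemma runs_label_sides:
  assumes s: "holds_input s"
  shows "runs (split_vertices (Lab\<^bold>[\<^bold>!Base \<^bold>+ \<^bold>!Vert\<^bold>] ::= \<^bold>!BitA) (Lab\<^bold>[\<^bold>!Base \<^bold>+ \<^bold>!Vert\<^bold>] ::= \<^bold>!BitB)) s
    (36 * input_size)
    (\<lambda>s'. (\<forall>v<n. (s DistA v < s DistB v \<longrightarrow> s' Lab (s Base 0 + v) = s BitA 0) \<and>
        (s DistB v < s DistA v \<longrightarrow> s' Lab (s Base 0 + v) = s BitB 0)) \<and>
      (\<forall>x<s Base 0. s' Lab x = s Lab x))"
proof -
  let ?body = "IF DistA\<^bold>[\<^bold>!Vert\<^bold>] \<^bold>< DistB\<^bold>[\<^bold>!Vert\<^bold>] THEN Lab\<^bold>[\<^bold>!Base \<^bold>+ \<^bold>!Vert\<^bold>] ::= \<^bold>!BitA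
    ELSE IF DistB\<^bold>[\<^bold>!Vert\<^bold>] \<^bold>< DistA\<^bold>[\<^bold>!Vert\<^bold>] THEN Lab\<^bold>[\<^bold>!Base \<^bold>+ \<^bold>!Vert\<^bold>] ::= \<^bold>!BitB ELSE Skip"
  let ?Y = "insert Vert (mods ?body)"
  let ?I = "\<lambda>i (s' :: memory). (\<forall>v<i. (s DistA v < s DistB v \<longrightarrow> s' Lab (s Base 0 + v) = s BitA 0) \<and>
        (s DistB v < s DistA v \<longrightarrow> s' Lab (s Base 0 + v) = s BitB 0)) \<and>
      (\<forall>x<s Base 0. s' Lab x = s Lab x)"
  have "runs (split_vertices (Lab\<^bold>[\<^bold>!Base \<^bold>+ \<^bold>!Vert\<^bold>] ::= \<^bold>!BitA) (Lab\<^bold>[\<^bold>!Base \<^bold>+ \<^bold>!Vert\<^bold>] ::= \<^bold>!BitB)) s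
    (36 * input_size) (\<lambda>s'. ?I n s' \<and> s' Vert 0 = n \<and> agree_off ?Y s s')"
    unfolding split_vertices_def
  proof (rule runs_for_loop[where I = ?I and l = 0 and B = "\<lambda>_. 24"])
    fix i s1
    assume fr: "agree_off ?Y s s1" and s1: "s1 Vert 0 = i" and I: "?I i s1"
    have keep: "s1 DistA = s DistA" "s1 DistB = s DistB" "s1 Base = s Base" "s1 BitA = s BitA" "s1 BitB = s BitB"
      using agree_offD[OF fr, of DistA] agree_offD[OF fr, of DistB] agree_offD[OF fr, of Base]
        agree_offD[OF fr, of BitA] agree_offD[OF fr, of BitB] by simp_all
    show "runs ?body s1 24 (\<lambda>s2. s2 Vert 0 = i \<and> ?I (Suc i) (s2(Vert := (s2 Vert)(0 := Suc i))))"
      by (rule runs_loop_free) (use I in \<open>auto simp: s1 keep less_Suc_eq\<close>)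
  next
    fix s' assume fr: "agree_off ?Y s s'"
    show "aval \<^bold>!Size s' = n" using agree_offD[OF fr, of Size] holds_inputD[OF s(1)] by simp
  qed (use s in \<open>simp_all add: input_size_def\<close>)
  then show ?thesis by (rule runs_mono) auto
qed

definition labels_sides :: "nat \<Rightarrow> nat \<Rightarrow> (nat \<Rightarrow> nat) \<Rightarrow> bool" where
  "labels_sides a b lab \<longleftrightarrow>
     (if card (W G a b) \<ge> card (W G b a)
      then (\<forall>w \<in> W G a b. lab w = 0) \<and> (\<forall>w \<in> W G b a. lab w = 1)
      else (\<forall>w \<in> W G b a. lab w = 0) \<and> (\<forall>w \<in> W G a b. lab w = 1))"

abbreviation label_class :: com where
  "label_class \<equiv>
     choose_edge ;;
     end_distances ;;
     CountA :== Const 0 ;;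
     CountB :== Const 0 ;;
     split_vertices (incr CountA) (incr CountB) ;;
     IF \<^bold>!CountA \<^bold>< \<^bold>!CountB
     THEN (BitA :== Const 1 ;; BitB :== Const 0)
     ELSE (BitA :== Const 0 ;; BitB :== Const 1) ;;
     split_vertices (Lab\<^bold>[\<^bold>!Base \<^bold>+ \<^bold>!Vert\<^bold>] ::= \<^bold>!BitA) (Lab\<^bold>[\<^bold>!Base \<^bold>+ \<^bold>!Vert\<^bold>] ::= \<^bold>!BitB) ;;
     Base :== \<^bold>!Base \<^bold>+ \<^bold>!Size"

text \<open>Which arc is taken depends on \<open>Choice\<close>, so the result only claims that a
  suitable arc exists; \<open>algorithm_output\<close> likewise quantifies existentially over the
  ends of the chosen edges.\<close>

lemma runs_label_class:
  assumes s: "holds_input s" "holds_tails s" and ex: "\<exists>j<num_arc. s Cls j = s Class 0"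
  shows "runs label_class s (310 * input_size)
    (\<lambda>s'. (\<exists>e<num_arc. s Cls e = s Class 0 \<and>
        labels_sides (tail_of e) (adj e) (\<lambda>v. s' Lab (s Base 0 + v))) \<and>
      (\<forall>x<s Base 0. s' Lab x = s Lab x) \<and> s' Base 0 = s Base 0 + n)"
    (is "runs _ _ _ ?Q")
proof (rule runs_Seq_frame[OF runs_choose_edge[OF s(1) ex]])
  let ?labels = "split_vertices (Lab\<^bold>[\<^bold>!Base \<^bold>+ \<^bold>!Vert\<^bold>] ::= \<^bold>!BitA) (Lab\<^bold>[\<^bold>!Base \<^bold>+ \<^bold>!Vert\<^bold>] ::= \<^bold>!BitB)"
  let ?count = "split_vertices (incr CountA) (incr CountB)"
  let ?bits = "IF \<^bold>!CountA \<^bold>< \<^bold>!CountB THEN (BitA :== Const 1 ;; BitB :== Const 0)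
     ELSE (BitA :== Const 0 ;; BitB :== Const 1)"
  let ?base = "Base :== \<^bold>!Base \<^bold>+ \<^bold>!Size"
  fix s1 assume "s1 Edge 0 < num_arc \<and> s Cls (s1 Edge 0) = s Class 0"
    and fr1: "agree_off (mods choose_edge) s s1"
  then obtain e where e: "s1 Edge 0 = e" "e < num_arc" "s Cls e = s Class 0" by blast
  have i1: "holds_input s1" using holds_input_agree_off[OF s(1) fr1] by simp
  have t1: "holds_tails s1" using holds_tails_agree_off[OF s(2) fr1] by simp
  have k1: "s1 Lab = s Lab" "s1 Base = s Base"
    using agree_offD[OF fr1, of Lab] agree_offD[OF fr1, of Base] by simp_all
  show "runs (end_distances ;; CountA :== Const 0 ;; CountB :== Const 0 ;; ?count ;; ?bits ;; ?labels ;; ?base)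
    s1 (260 * input_size) ?Q"
  proof (rule runs_Seq_frame[OF runs_end_distances[OF i1 t1 e(1,2)]])
    fix s2 assume d2: "holds_distances e s2" and fr2: "agree_off (mods end_distances) s1 s2"
    have i2: "holds_input s2" using holds_input_agree_off[OF i1 fr2] by simp
    have k2: "s2 Lab = s Lab" "s2 Base = s Base"
      using agree_offD[OF fr2, of Lab] agree_offD[OF fr2, of Base] k1 by simp_all
    define s3 where "s3 = effect (CountB :== Const 0) (effect (CountA :== Const 0) s2)"
    have s3: "holds_input s3" "s3 CountA 0 = 0" "s3 CountB 0 = 0"
      using i2 by (simp_all add: s3_def holds_input_def)
    have k3: "s3 DistA = s2 DistA" "s3 DistB = s2 DistB" "s3 Lab = s Lab" "s3 Base = s Base"
      using k2 by (simp_all add: s3_def)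
    have "runs (?count ;; ?bits ;; ?labels ;; ?base) s3 (100 * input_size) ?Q"
    proof (rule runs_Seq_frame[OF runs_count_sides[OF s3]])
      fix s4 assume c4: "s4 CountA 0 = card {v. v < n \<and> s3 DistA v < s3 DistB v} \<and>
          s4 CountB 0 = card {v. v < n \<and> s3 DistB v < s3 DistA v}"
        and fr4: "agree_off (mods ?count) s3 s4"
      have i4: "holds_input s4" using holds_input_agree_off[OF s3(1) fr4] by simp
      have k4: "s4 DistA = s2 DistA" "s4 DistB = s2 DistB" "s4 Lab = s Lab" "s4 Base = s Base"
        using agree_offD[OF fr4, of DistA] agree_offD[OF fr4, of DistB]
          agree_offD[OF fr4, of Lab] agree_offD[OF fr4, of Base] k3 by simp_all
      define s5 where "s5 = effect ?bits s4"
      have i5: "holds_input s5" using i4 by (simp add: s5_def holds_input_def)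
      have k5: "s5 DistA = s2 DistA" "s5 DistB = s2 DistB" "s5 Lab = s Lab" "s5 Base = s Base"
        using k4 by (simp_all add: s5_def)
      have b5: "s5 BitA 0 = (if card (W G (tail_of e) (adj e)) < card (W G (adj e) (tail_of e)) then 1 else 0)"
        "s5 BitB 0 = (if card (W G (tail_of e) (adj e)) < card (W G (adj e) (tail_of e)) then 0 else 1)"
        using c4 k3 W_holds_distances[OF d2] by (simp_all add: s5_def)
      have "runs (?labels ;; ?base) s5 (36 * input_size + 7) ?Q"
      proof (rule runs_Seq_frame[OF runs_label_sides[OF i5]])
        fix s6
        assume l6: "(\<forall>v<n. (s5 DistA v < s5 DistB v \<longrightarrow> s6 Lab (s5 Base 0 + v) = s5 BitA 0) \<and>
            (s5 DistB v < s5 DistA v \<longrightarrow> s6 Lab (s5 Base 0 + v) = s5 BitB 0)) \<and>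
          (\<forall>x<s5 Base 0. s6 Lab x = s5 Lab x)"
          and fr6: "agree_off (mods ?labels) s5 s6"
        have k6: "s6 Base = s Base" "s6 Size 0 = n"
          using agree_offD[OF fr6, of Base] agree_offD[OF fr6, of Size] k5 holds_inputD[OF i5] by simp_all
        have "labels_sides (tail_of e) (adj e) (\<lambda>v. s6 Lab (s Base 0 + v))"
          unfolding labels_sides_def using l6 k5 b5 W_holds_distances[OF d2] by auto
        moreover have "\<forall>x<s Base 0. s6 Lab x = s Lab x" using l6 k5 by simp
        ultimately show "runs ?base s6 7 ?Q"
          using e k6 by (intro runs_loop_free) auto
      qed simp
      note rest = this[unfolded s5_def]
      show "runs (?bits ;; ?labels ;; ?base) s4 (60 * input_size) ?Q"
        by (rule runs_mono[OF runs_loop_free_Seq[OF _ rest]]) (use input_size_ge in simp_all)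
    qed simp
    note rest = this[unfolded s3_def]
    show "runs (CountA :== Const 0 ;; CountB :== Const 0 ;; ?count ;; ?bits ;; ?labels ;; ?base) s2
      (110 * input_size) ?Q"
      by (rule runs_mono[OF runs_loop_free_Seq[OF _ runs_loop_free_Seq[OF _ rest]]])
        (use input_size_ge in simp_all)
  qed simp
qed simp

lemma classes_inv_Cls:
  assumes "classes_inv L num_arc s" "j < num_arc"
  shows "s Cls j < length L" "L ! s Cls j = dir_of j"
  using assms by (auto simp: classes_inv_def)

lemma length_classes:
  assumes "classes_inv L num_arc s"
  shows "length L \<le> n"
proof -
  have "length L = card (dir_of ` {..<num_arc})"
    using assms distinct_card[of L] by (simp add: classes_inv_def)
  then show ?thesis using card_directions by simp
qed

lemma classes_inv_index:
  assumes inv: "classes_inv L num_arc s" and j: "j < num_arc" and i: "i < length L"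
  shows "s Cls j = i \<longleftrightarrow> dir_of j = L ! i"
  using classes_inv_Cls[OF inv j] inv i nth_eq_iff_index_eq[of L "s Cls j" i]
  by (auto simp: classes_inv_def)

text \<open>The machine has no multiplication, so \<open>Base\<close> carries \<open>m * n\<close>
  along; the invariant ties it to the index of the current class.\<close>

lemma runs_compute_labels:
  assumes s: "holds_input s" "holds_tails s" and inv: "classes_inv L num_arc s"
  shows "runs compute_labels s (20 + 330 * (n * input_size))
    (\<lambda>s'. \<forall>i<length L. \<exists>e<num_arc. dir_of e = L ! i \<and>
      labels_sides (tail_of e) (adj e) (\<lambda>v. s' Lab (i * n + v)))"
proof -
  let ?I = "\<lambda>m (s' :: memory). s' Base 0 = m * n \<and> (\<forall>i<m. \<exists>e<num_arc. dir_of e = L ! i \<and>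
      labels_sides (tail_of e) (adj e) (\<lambda>v. s' Lab (i * n + v)))"
  let ?Y = "insert Class (mods label_class)"
  let ?loop = "for_loop Class (Const 0) \<^bold>!NumCls label_class"
  define s1 where "s1 = effect (Base :== Const 0) s"
  have s1: "holds_input s1" "holds_tails s1" "s1 Cls = s Cls" "s1 NumCls = s NumCls" "s1 Base 0 = 0"
    using s by (simp_all add: s1_def holds_input_def holds_tails_def)
  have NumCls: "s NumCls 0 = length L" using inv by (simp add: classes_inv_def)
  have "runs ?loop s1 (10 + 330 * (n * input_size))
      (\<lambda>s'. ?I (length L) s' \<and> s' Class 0 = length L \<and> agree_off ?Y s1 s')"
  proof (rule runs_for_loop[where I = ?I and l = 0 and B = "\<lambda>_. 310 * input_size"])
    fix m s2
    assume m: "m < length L" and fr: "agree_off ?Y s1 s2" and s2: "s2 Class 0 = m" and I: "?I m s2"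
    have i2: "holds_input s2" using holds_input_agree_off[OF s1(1) fr] by simp
    have t2: "holds_tails s2" using holds_tails_agree_off[OF s1(2) fr] by simp
    have Cls: "s2 Cls = s Cls" using agree_offD[OF fr, of Cls] s1 by simp
    have "L ! m \<in> dir_of ` {..<num_arc}" using m inv nth_mem[of m L] by (simp add: classes_inv_def)
    then obtain j where "j < num_arc" "dir_of j = L ! m" by auto
    then have "\<exists>j<num_arc. s2 Cls j = s2 Class 0"
      using classes_inv_index[OF inv _ m] s2 Cls by auto
    note step = runs_frame[OF runs_label_class[OF i2 t2 this]]
    show "runs label_class s2 (310 * input_size)
      (\<lambda>s3. s3 Class 0 = m \<and> ?I (Suc m) (s3(Class := (s3 Class)(0 := Suc m))))"
    proof (rule runs_mono[OF step])
      fix s3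
      assume *: "((\<exists>e<num_arc. s2 Cls e = s2 Class 0 \<and>
          labels_sides (tail_of e) (adj e) (\<lambda>v. s3 Lab (s2 Base 0 + v))) \<and>
        (\<forall>x<s2 Base 0. s3 Lab x = s2 Lab x) \<and> s3 Base 0 = s2 Base 0 + n) \<and>
        agree_off (mods label_class) s2 s3"
      then have Class: "s3 Class = s2 Class" using agree_offD[of "mods label_class" s2 s3 Class] by simp
      have "\<exists>e<num_arc. dir_of e = L ! i \<and> labels_sides (tail_of e) (adj e) (\<lambda>v. s3 Lab (i * n + v))"
        if "i < Suc m" for i
      proof (cases "i = m")
        case True
        obtain e where "e < num_arc" "s2 Cls e = s2 Class 0"
          "labels_sides (tail_of e) (adj e) (\<lambda>v. s3 Lab (m * n + v))" using * I by auto
        then show ?thesis using True classes_inv_index[OF inv _ m, of e] s2 Cls by auto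
      next
        case False
        then have "i < m" using that by simp
        then obtain e where e: "e < num_arc" "dir_of e = L ! i"
          "labels_sides (tail_of e) (adj e) (\<lambda>v. s2 Lab (i * n + v))" using I by auto
        \<comment> \<open>The block of an earlier coordinate \<open>i\<close> ends at or before cell
          \<open>m * n\<close>, below the cells written in this round.\<close>
        have "s3 Lab (i * n + w) = s2 Lab (i * n + w)" if "w < n" for w
        proof -
          have "i * n + w < Suc i * n" using that by simp
          also have "\<dots> \<le> m * n" using \<open>i < m\<close> by (intro mult_le_mono1) simp
          finally show ?thesis using * I by auto
        qed
        then have "labels_sides (tail_of e) (adj e) (\<lambda>v. s3 Lab (i * n + v))"
          using e(3) by (simp add: labels_sides_def W_def verts_eq)
        then show ?thesis using e by blast
      qed
      then show "s3 Class 0 = m \<and> ?I (Suc m) (s3(Class := (s3 Class)(0 := Suc m)))"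
        using * I Class s2 by simp
    qed simp
  next
    fix s' assume fr: "agree_off ?Y s1 s'"
    show "aval \<^bold>!NumCls s' = length L" using agree_offD[OF fr, of NumCls] s1 NumCls by simp
  next
    have "length L * (310 * input_size + 12) \<le> n * (330 * input_size)"
      using length_classes[OF inv] input_size_ge by (intro mult_le_mono) simp_all
    then show "acost (Const 0) + acost \<^bold>!NumCls + 6 +
        (\<Sum>i=0..<length L. 310 * input_size + acost \<^bold>!NumCls + 10) \<le> 10 + 330 * (n * input_size)"
      by (simp add: algebra_simps)
  qed (simp_all add: s1)
  then have "runs ?loop s1 (10 + 330 * (n * input_size)) (\<lambda>s'. \<forall>i<length L. \<exists>e<num_arc. dir_of e = L ! i \<and>
      labels_sides (tail_of e) (adj e) (\<lambda>v. s' Lab (i * n + v)))"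
    by (rule runs_mono) auto
  note rest = this[unfolded s1_def]
  show ?thesis unfolding compute_labels_def
    by (rule runs_mono[OF runs_loop_free_Seq[OF _ rest]]) simp_all
qed

section \<open>Total running time and the stored result\<close>

lemma runs_labelling_program:
  assumes s: "holds_input s"
  shows "runs labelling_program s (110 * input_size + 540 * (n * input_size))
    (\<lambda>s'. holds_input s' \<and> holds_tails s' \<and> (\<exists>L. classes_inv L num_arc s' \<and>
      (\<forall>i<length L. \<exists>e<num_arc. dir_of e = L ! i \<and>
        labels_sides (tail_of e) (adj e) (\<lambda>v. s' Lab (i * n + v)))))"
    (is "runs _ _ _ ?Q")
  unfolding labelling_program_def
proof (rule runs_Seq_frame[OF runs_compute_tails[OF s]])
  fix s1 assume "\<forall>j<num_arc. s1 Tail j = tail_of j" and fr1: "agree_off (mods compute_tails) s s1"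
  then have t1: "holds_tails s1" by (simp add: holds_tails_def)
  have i1: "holds_input s1" using holds_input_agree_off[OF s fr1] by simp
  show "runs (compute_theta_classes ;; compute_labels) s1 (60 * input_size + 540 * (n * input_size) + 20) ?Q"
  proof (rule runs_Seq_frame[OF runs_compute_theta_classes[OF i1 t1]])
    fix s2 assume "\<exists>L. classes_inv L num_arc s2" and fr2: "agree_off (mods compute_theta_classes) s1 s2"
    then obtain L where L: "classes_inv L num_arc s2" by blast
    have i2: "holds_input s2" using holds_input_agree_off[OF i1 fr2] by simp
    have t2: "holds_tails s2" using holds_tails_agree_off[OF t1 fr2] by simp
    show "runs compute_labels s2 (20 + 330 * (n * input_size)) ?Q"
    proof (rule runs_mono[OF runs_frame[OF runs_compute_labels[OF i2 t2 L]] le_refl])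
      fix s3 assume *: "(\<forall>i<length L. \<exists>e<num_arc. dir_of e = L ! i \<and>
          labels_sides (tail_of e) (adj e) (\<lambda>v. s3 Lab (i * n + v))) \<and> agree_off (mods compute_labels) s2 s3"
      then have fr3: "agree_off (mods compute_labels) s2 s3" by simp
      have "holds_input s3" using holds_input_agree_off[OF i2 fr3] by simp
      moreover have "holds_tails s3" using holds_tails_agree_off[OF t2 fr3] by simp
      moreover have "classes_inv L num_arc s3"
        using L agree_offD[OF fr3, of Cls] agree_offD[OF fr3, of NumCls] by (simp add: classes_inv_def)
      ultimately show "?Q s3" using * by blast
    qed
  qed simp
qed (simp add: input_size_def)

text \<open>If \<open>n \<le> 1\<close>, there are no arcs and the time is constant; otherwise there are at least \<open>n\<close> arcs.\<close>

lemma time_bound: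
  "110 * input_size + 540 * (n * input_size) \<le> 5000 * max 1 (card (edges G) * n)"
proof (cases "n \<le> 1")
  case True
  then have "input_size \<le> 2" using num_arc_eq_0[OF True] by (simp add: input_size_def)
  moreover have "n * input_size \<le> 1 * 2" using True calculation by (rule mult_le_mono)
  ultimately show ?thesis by linarith
next
  case False
  \<comment> \<open>Here \<open>n \<le> num_arc\<close> and
    \<open>num_arc \<le> 2 * card (edges G)\<close>, and an edge exists, so each of
    \<open>n\<close>, \<open>num_arc\<close> and 1 is at most twice the number of edges. The total
    is then at most 650 times \<open>n * input_size\<close>, that is, 3900 times
    \<open>card (edges G) * n\<close>, within the factor 5000.\<close>
  then have w: "input_size \<le> 6 * card (edges G)"
    using le_num_arc num_arc_le by (simp add: input_size_def)
  have "1 * input_size \<le> n * input_size" using False by (intro mult_le_mono1) simp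
  moreover have "n * input_size \<le> n * (6 * card (edges G))" using w by (rule mult_le_mono2)
  moreover have "n * (6 * card (edges G)) = 6 * (card (edges G) * n)" by simp
  ultimately have "110 * input_size + 540 * (n * input_size) \<le> 5000 * (card (edges G) * n)"
    by linarith
  then show ?thesis by linarith
qed

text \<open>The label bits are decoded from memory by comparing cells with 1. This is faithful only
  if every cell of the label blocks holds 0 or 1, although the memory was not initialised.\<close>

lemma algorithm_output_stored:
  assumes i: "holds_input s" and t: "holds_tails s" and inv: "classes_inv L num_arc s"
    and lab: "\<forall>i<length L. \<exists>e<num_arc. dir_of e = L ! i \<and>
        labels_sides (tail_of e) (adj e) (\<lambda>v. s Lab (i * n + v))"
  obtains \<phi> where "stores_labelling s G (length (stored_classes s)) \<phi>"
    "algorithm_output G (stored_classes s) \<phi>"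
proof -
  define \<phi> where "\<phi> v = map (\<lambda>i. s Lab (i * n + v) = 1) [0..<length L]" for v
  note iD = holds_inputD[OF i]
  have dL: "distinct L" and setL: "set L = dir_of ` {..<num_arc}" and NumCls: "s NumCls 0 = length L"
    using inv by (simp_all add: classes_inv_def)
  have Lk: "L ! m < k" if "m < length L" for m
    using nth_mem[OF that] setL dir_of by auto
  have cls: "stored_classes s = map dir_class L"
  proof (rule nth_equalityI)
    show "length (stored_classes s) = length (map dir_class L)" by (simp add: stored_classes_def NumCls)
    fix m assume "m < length (stored_classes s)"
    then have m: "m < length L" by (simp add: stored_classes_def NumCls)
    have "stored_classes s ! m = {{s Tail j, adj j} |j. j < num_arc \<and> s Cls j = m}"
      using m by (simp add: stored_classes_def NumCls iD)
    also have "\<dots> = {{tail_of j, adj j} |j. j < num_arc \<and> dir_of j = L ! m}"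
      using t classes_inv_index[OF inv _ m] by (auto simp: holds_tails_def) metis+
    also have "\<dots> = dir_class (L ! m)" by (rule dir_class_arcs[OF Lk[OF m], symmetric])
    finally show "stored_classes s ! m = map dir_class L ! m" using m by simp
  qed
  have arc_mem: "{tail_of j, adj j} \<in> dir_class (dir_of j)" if "j < num_arc" for j
    using arc_edge[OF that] dir_of[OF that] by (simp add: doubleton_in_dir_class)
  have "inj_on dir_class (set L)"
  proof (rule inj_onI)
    fix a b assume ab: "a \<in> set L" "b \<in> set L" "dir_class a = dir_class b"
    then obtain j where j: "j < num_arc" "a = dir_of j" using setL by auto
    moreover have "b < k" using ab(2) setL dir_of by auto
    ultimately show "a = b" using arc_mem[OF j(1)] ab(3) dir_class_disjoint[of _ a b] dir_of(1) by auto
  qed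
  then have dist: "distinct (stored_classes s)" unfolding cls using dL by (simp add: distinct_map)
  have set: "set (stored_classes s) = theta_classes G"
  proof -
    have "set (stored_classes s) = dir_class ` dir_of ` {..<num_arc}" by (simp add: cls setL)
    also have "\<dots> = {dir_class i |i. i < k \<and> dir_class i \<noteq> {}}"
    proof (intro subset_antisym subsetI)
      fix A assume "A \<in> dir_class ` dir_of ` {..<num_arc}"
      then obtain j where "j < num_arc" "A = dir_class (dir_of j)" by auto
      then show "A \<in> {dir_class i |i. i < k \<and> dir_class i \<noteq> {}}" using arc_mem dir_of(1) by blast
    next
      fix A assume "A \<in> {dir_class i |i. i < k \<and> dir_class i \<noteq> {}}"
      then obtain i where i: "i < k" "A = dir_class i" "dir_class i \<noteq> {}" by auto
      then obtain j where "j < num_arc" "dir_of j = i" using dir_class_arcs[OF i(1)] by auto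
      then show "A \<in> dir_class ` dir_of ` {..<num_arc}" using i by auto
    qed
    finally show ?thesis by (simp add: theta_classes_eq)
  qed
  \<comment> \<open>The distances from a vertex to the two ends of an edge never coincide, so the
    two sides cover all vertices and every cell of a block gets written.\<close>
  have sides: "w \<in> W G (tail_of e) (adj e) \<or> w \<in> W G (adj e) (tail_of e)" if "e < num_arc" "w < n" for e w
  proof -
    have "w \<in> verts G" using that verts_eq by simp
    then show ?thesis using gdist_edge_ends[OF arc_edge[OF that(1)] dir_of[OF that(1)], of w]
      by (auto simp: W_def split: if_splits)
  qed
  have bit: "s Lab (m * n + w) = 0 \<or> s Lab (m * n + w) = 1" if m: "m < length L" and w: "w < n" for m w
  proof -
    obtain e where e: "e < num_arc" "labels_sides (tail_of e) (adj e) (\<lambda>v. s Lab (m * n + v))"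
      using lab m by blast
    then show ?thesis using sides[OF e(1) w] by (auto simp: labels_sides_def split: if_splits)
  qed
  have "stores_labelling s G (length (stored_classes s)) \<phi>"
    unfolding stores_labelling_def using bit by (force simp: cls \<phi>_def verts_eq)
  moreover have "algorithm_output G (stored_classes s) \<phi>"
  proof -
    obtain e where e: "\<And>m. m < length L \<Longrightarrow> e m < num_arc \<and> dir_of (e m) = L ! m \<and>
        labels_sides (tail_of (e m)) (adj (e m)) (\<lambda>v. s Lab (m * n + v))"
      using lab by metis
    have choice: "{tail_of (e m), adj (e m)} \<in> stored_classes s ! m \<and>
        (if card (W G (tail_of (e m)) (adj (e m))) \<ge> card (W G (adj (e m)) (tail_of (e m)))
         then (\<forall>w \<in> W G (tail_of (e m)) (adj (e m)). \<phi> w ! m = False) \<and>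
           (\<forall>w \<in> W G (adj (e m)) (tail_of (e m)). \<phi> w ! m = True)
         else (\<forall>w \<in> W G (adj (e m)) (tail_of (e m)). \<phi> w ! m = False) \<and>
           (\<forall>w \<in> W G (tail_of (e m)) (adj (e m)). \<phi> w ! m = True))"
      if "m < length (stored_classes s)" for m
    proof -
      have m: "m < length L" using that by (simp add: cls)
      then show ?thesis using e[OF m] arc_mem[of "e m"] by (auto simp: cls labels_sides_def \<phi>_def)
    qed
    show ?thesis unfolding algorithm_output_def
      by (intro conjI dist set, simp add: cls \<phi>_def, rule exI[of _ "\<lambda>m. tail_of (e m)"],
          rule exI[of _ "\<lambda>m. adj (e m)"], use choice in blast)
  qed
  ultimately show ?thesis by (rule that)
qed

end

lemma labelling_program_correct:
  assumes G: "is_daisy_cube G" and rep: "represents s G"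
  shows "\<exists>t s' \<Theta>s \<phi>.
    exec labelling_program s t s' \<and> t \<le> 5000 * max 1 (card (edges G) * card (verts G)) \<and>
    \<Theta>s = stored_classes s' \<and> stores_labelling s' G (length \<Theta>s) \<phi> \<and>
    algorithm_output G \<Theta>s \<phi> \<and> proper_labelling G (length \<Theta>s) \<phi>"
proof -
  obtain k f where "daisy_graph G k f" using daisy_graph_if_is_daisy_cube[OF G] .
  then interpret daisy_graph G k f .
  have rv: "s Off v \<le> s Off (Suc v)" "distinct (map (s Adj) [s Off v..<s Off (Suc v)])"
    "set (map (s Adj) [s Off v..<s Off (Suc v)]) = {w. {v, w} \<in> edges G}" if "v < s Size 0" for v
    using rep that unfolding represents_def by blast+
  interpret daisy_input G k f "s Size 0" "s Off" "s Adj"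
  proof
    show "verts G = {..<s Size 0}" "s Off 0 = 0" using rep by (simp_all add: represents_def)
    show "s Off v \<le> s Off (Suc v)" if "v < s Size 0" for v by (rule rv(1)[OF that])
    show "inj_on (s Adj) {s Off v..<s Off (Suc v)}" if "v < s Size 0" for v
      using rv(2)[OF that] by (simp add: distinct_map)
    show "s Adj ` {s Off v..<s Off (Suc v)} = {w. {v, w} \<in> edges G}" if "v < s Size 0" for v
      using rv(3)[OF that] by simp
  qed
  have "holds_input s" by (simp add: holds_input_def)
  from runs_labelling_program[OF this] obtain t s' L where ex: "exec labelling_program s t s'"
    and t: "t \<le> 110 * input_size + 540 * (s Size 0 * input_size)"
    and s': "holds_input s'" "holds_tails s'" "classes_inv L (s Off (s Size 0)) s'"
      "\<forall>i<length L. \<exists>e<s Off (s Size 0). dir_of e = L ! i \<and>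
        labels_sides (tail_of e) (s Adj e) (\<lambda>v. s' Lab (i * s Size 0 + v))"
    unfolding runs_def by blast
  obtain \<phi> where \<phi>: "stores_labelling s' G (length (stored_classes s')) \<phi>"
    "algorithm_output G (stored_classes s') \<phi>"
    using algorithm_output_stored[OF s'] .
  moreover have "t \<le> 5000 * max 1 (card (edges G) * card (verts G))"
    using t time_bound by (simp add: verts_eq)
  ultimately show ?thesis
    using ex proper_labelling_if_algorithm_output[OF \<phi>(2)] by blast
qed

theorem theorem3p4:
  shows "(\<forall>(G :: 'a sgraph) \<Theta>s \<phi>.
            is_daisy_cube G \<and> algorithm_output G \<Theta>s \<phi> \<longrightarrow>
            proper_labelling G (length \<Theta>s) \<phi>) \<and>
         (\<exists>C :: nat. \<forall>(G :: nat sgraph) n m s.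
            is_daisy_cube G \<and> n = card (verts G) \<and> m = card (edges G) \<and> represents s G \<longrightarrow>
            (\<exists>t s' \<Theta>s \<phi>.
               exec labelling_program s t s' \<and> t \<le> C * max 1 (m * n) \<and>
               \<Theta>s = stored_classes s' \<and> stores_labelling s' G (length \<Theta>s) \<phi> \<and>
               algorithm_output G \<Theta>s \<phi> \<and> proper_labelling G (length \<Theta>s) \<phi>))"
proof (intro conjI allI impI)
  fix G :: "'a sgraph" and \<Theta>s \<phi>
  assume *: "is_daisy_cube G \<and> algorithm_output G \<Theta>s \<phi>"
  obtain k f where "daisy_graph G k f" using daisy_graph_if_is_daisy_cube * by blast
  then show "proper_labelling G (length \<Theta>s) \<phi>"
    using * by (intro daisy_graph.proper_labelling_if_algorithm_output) auto
next
  show "\<exists>C :: nat. \<forall>(G :: nat sgraph) n m s.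
            is_daisy_cube G \<and> n = card (verts G) \<and> m = card (edges G) \<and> represents s G \<longrightarrow>
            (\<exists>t s' \<Theta>s \<phi>.
               exec labelling_program s t s' \<and> t \<le> C * max 1 (m * n) \<and>
               \<Theta>s = stored_classes s' \<and> stores_labelling s' G (length \<Theta>s) \<phi> \<and>
               algorithm_output G \<Theta>s \<phi> \<and> proper_labelling G (length \<Theta>s) \<phi>)"
  proof (rule exI[of _ 5000], intro allI impI)
    fix G :: "nat sgraph" and n m s
    assume "is_daisy_cube G \<and> n = card (verts G) \<and> m = card (edges G) \<and> represents s G"
    then show "\<exists>t s' \<Theta>s \<phi>.
               exec labelling_program s t s' \<and> t \<le> 5000 * max 1 (m * n) \<and>
               \<Theta>s = stored_classes s' \<and> stores_labelling s' G (length \<Theta>s) \<phi> \<and>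
               algorithm_output G \<Theta>s \<phi> \<and> proper_labelling G (length \<Theta>s) \<phi>"
      using labelling_program_correct[of G s] by simp
  qed
qed

end
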